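(* Let $r$ be a positive integer. The equation $$\{h,\tau\}=2\pi^2r^2E_4(\tau),\qquad \tau\in\mathbb H,$$ has a solution $h_r$, meromorphic on $\mathbb H$, that is equivariant for $\mathrm{SL}_2(\mathbb Z)$, that is, $h_r(\gamma\cdot\tau)=\gamma\cdot h_r(\tau)$ for all $\gamma\in\mathrm{SL}_2(\mathbb Z)$ and $\tau\in\mathbb H$.
   Context: $\mathbb H=\{\tau\in\mathbb C : \mathrm{Im}\,\tau>0\}$. For a nonconstant meromorphic function $h$, the Schwarz derivative is $\{h,\tau\}=\left(\frac{h''}{h'}\right)'-\frac12\left(\frac{h''}{h'}\right)^2$, with derivatives taken with respect to $\tau$. $E_4(\tau)=1+240\sum_{n\ge1}\sigma_3(n)q^n$, with $q=e^{2\pi i\tau}$ and $\sigma_3(n)$ the sum of the cubes of the positive divisors of $n$, is the weight 4 Eisenstein series. Matrices act on $\mathbb H$ and on $\mathbb C\cup\{\infty\}$ by linear fractional transformations: $\begin{pmatrix}a&b\\c&d\end{pmatrix}\cdot z=\frac{az+b}{cz+d}$. *)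

theory Defs
  imports "HOL-Complex_Analysis.Complex_Analysis"
begin

definition upper_half_plane :: "complex set" where
  "upper_half_plane = {\<tau>. Im \<tau> > 0}"

definition sigma3 :: "nat \<Rightarrow> nat" where
  "sigma3 n = (\<Sum>d | d dvd n. d ^ 3)"

(* The series is shifted to start at index 0, i.e. its k-th term is the q^(k+1) term. *)
definition E4 :: "complex \<Rightarrow> complex" where
  "E4 \<tau> = 1 + 240 * (\<Sum>k. of_nat (sigma3 (Suc k)) * exp (2 * of_real pi * \<i> * \<tau>) ^ Suc k)"

(* The Schwarz derivative of a meromorphic function is again a meromorphic function.  The defining
   formula is evaluated pointwise where h is holomorphic with h' \<noteq> 0; remove_sings extends it
   over the remaining, isolated points (poles of h and zeros of h') by continuity wherever the
   singularity is removable, e.g. at simple poles of h. *)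
definition schwarzian :: "(complex \<Rightarrow> complex) \<Rightarrow> complex \<Rightarrow> complex" where
  "schwarzian h = remove_sings (\<lambda>\<tau>.
     deriv (\<lambda>z. deriv (deriv h) z / deriv h z) \<tau>
       - 1 / 2 * (deriv (deriv h) \<tau> / deriv h \<tau>) ^ 2)"

(* The Riemann sphere is "complex option", with None as the point at infinity. *)
type_synonym sphere = "complex option"

(* The sphere-valued map of a meromorphic function.  It is intended for functions that are
   nicely_meromorphic_on a domain: these take the placeholder value 0 at their poles and their
   limit everywhere else. *)
definition sphere_val :: "(complex \<Rightarrow> complex) \<Rightarrow> complex \<Rightarrow> sphere" where
  "sphere_val h \<tau> = (if is_pole h \<tau> then None else Some (h \<tau>))"

definition SL2Z :: "(int ^ 2 ^ 2) set" where
  "SL2Z = {\<gamma>. det \<gamma> = 1}"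

definition act :: "int ^ 2 ^ 2 \<Rightarrow> complex \<Rightarrow> complex" where
  "act \<gamma> = moebius (of_int (\<gamma> $ 1 $ 1)) (of_int (\<gamma> $ 1 $ 2)) (of_int (\<gamma> $ 2 $ 1)) (of_int (\<gamma> $ 2 $ 2))"

definition sphere_act :: "int ^ 2 ^ 2 \<Rightarrow> sphere \<Rightarrow> sphere" where
  "sphere_act \<gamma> w =
     (case w of
        None \<Rightarrow> if \<gamma> $ 2 $ 1 = 0 then None
                else Some (of_int (\<gamma> $ 1 $ 1) / of_int (\<gamma> $ 2 $ 1))
      | Some z \<Rightarrow> if of_int (\<gamma> $ 2 $ 1) * z + of_int (\<gamma> $ 2 $ 2) = 0 then None
                  else Some (act \<gamma> z))"

end

theory Submission
  imports Defs
begin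

text \<open>
  The Schwarz equation is linearised in the usual way: if \<open>p\<close> and \<open>y\<close> are linearly independent
  solutions of \<open>f'' = - c E\<^sub>4 f\<close> with \<open>c = \<pi>\<^sup>2 r\<^sup>2\<close>, then \<open>h = p / y\<close> satisfies \<open>{h,\<tau>} = 2 c E\<^sub>4\<close>.
  Because \<open>E\<^sub>4\<close> is a modular form of weight 4, the space of solutions is stable under the weight \<open>-1\<close>
  action of the modular group, generated by \<open>f \<mapsto> f(\<tau> + 1)\<close> and \<open>f \<mapsto> \<tau> f(-1/\<tau>)\<close>. Equivariance
  of \<open>h\<close> says that, for a good basis, this action is projectively the standard representation.

  One solution is explicit. The exponents at the cusp are \<open>\<plusminus>r/2\<close>, and the Frobenius series
  \<open>y = q\<^bsup>r/2\<^esup> (1 + a\<^sub>1 q + a\<^sub>2 q\<^sup>2 + \<dots>)\<close> converges on the whole half-plane. It satisfies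
  \<open>y(\<tau> + 1) = \<epsilon> y(\<tau>)\<close> with \<open>\<epsilon> = (-1)\<^sup>r\<close>, and all its coefficients are nonnegative. The second
  solution is obtained from the first by the modular inversion, \<open>u(\<tau>) = \<tau> y(-1/\<tau>)\<close>. If \<open>u\<close> were a
  multiple of \<open>y\<close>, then comparing the values at \<open>2\<i>\<close> and \<open>\<i>/2\<close> would contradict the monotonicity of
  \<open>y\<close> on the imaginary axis; so the two solutions form a basis and their Wronskian is a nonzero constant.

  With this basis almost everything is forced. By construction the inversion acts as the standard
  one on \<open>(u, y)\<close> up to scalars. Since Wronskians are constant, \<open>u(\<tau> + 1) = \<epsilon> (u + b y)\<close> for some
  constant \<open>b\<close>, and the relation \<open>(ST)\<^sup>3 = -1\<close> in the modular group forces \<open>b\<^sup>2 = 1\<close>. Hence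
  \<open>h = b u / y\<close> satisfies \<open>h(\<tau> + 1) = h(\<tau>) + 1\<close> and \<open>h(-1/\<tau>) = -1/h(\<tau>)\<close>
  (\<open>equivariant_solution_pair\<close>), and equivariance for the whole group follows because the two
  corresponding matrices generate it (\<open>proj_equivariant_SL2Z\<close>).

  The modularity of \<open>E\<^sub>4\<close> (\<open>E4_minus_inverse\<close>) is proved from scratch: the lattice sum
  \<open>\<Sum> 1/(m + n\<tau>)\<^sup>4\<close> is visibly modular, and summing it row by row with the Lipschitz formula
  gives \<open>\<pi>\<^sup>4/45 E\<^sub>4\<close>.
\<close>

section \<open>The partial fraction expansion for fourth powers\<close>

lemma Digamma_reflection_complex:
  fixes z :: complex
  assumes "z \<notin> \<int>"
  shows "Digamma (1 - z) - Digamma z = of_real pi * cos (of_real pi * z) / sin (of_real pi * z)"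
proof -
  have nz: "z \<notin> \<int>\<^sub>\<le>\<^sub>0" and nz': "1 - z \<notin> \<int>\<^sub>\<le>\<^sub>0"
    using assms nonpos_Ints_subset_Ints Ints_1 Ints_diff[of 1 "1 - z"] by auto
  have s0: "sin (of_real pi * z) \<noteq> 0"
    using assms by (auto simp: sin_eq_0 Ints_def)
  have "((\<lambda>z. rGamma z * rGamma (1 - z)) has_field_derivative
          rGamma z * rGamma (1 - z) * (Digamma (1 - z) - Digamma z)) (at z)"
    by (rule derivative_eq_intros refl nz nz' | simp)+ (simp add: algebra_simps)
  moreover have "((\<lambda>z. rGamma z * rGamma (1 - z)) has_field_derivative cos (of_real pi * z)) (at z)"
    unfolding rGamma_reflection_complex
    by (rule derivative_eq_intros refl | simp)+
  ultimately have "rGamma z * rGamma (1 - z) * (Digamma (1 - z) - Digamma z) = cos (of_real pi * z)"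
    by (rule DERIV_unique)
  thus ?thesis
    using s0 by (simp add: rGamma_reflection_complex field_simps)
qed

text \<open>
  This is the third derivative of the reflection formula for the digamma function, taken one
  derivative at a time on the open complement of the integers. Its left-hand side is six times the
  two-sided sum of the \<open>1/(m + z)\<^sup>4\<close>.
\<close>
lemma Polygamma_3_reflection_complex:
  fixes z :: complex
  assumes "z \<notin> \<int>"
  shows "Polygamma 3 z + Polygamma 3 (1 - z) =
           of_real pi ^ 4 * (6 / sin (of_real pi * z) ^ 4 - 4 / sin (of_real pi * z) ^ 2)"
proof -
  define p where "p = complex_of_real pi"
  have op: "open (- \<int> :: complex set)"
    using closed_Ints by auto
  have nz: "w \<notin> \<int>\<^sub>\<le>\<^sub>0" "1 - w \<notin> \<int>\<^sub>\<le>\<^sub>0" if "w \<in> -\<int>" for w :: complex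
    using that nonpos_Ints_subset_Ints Ints_1 Ints_diff[of 1 "1 - w"] by auto
  have s0: "sin (p * w) \<noteq> 0" if "w \<in> -\<int>" for w
    using that by (auto simp: sin_eq_0 Ints_def p_def)
  have sc: "cos (p * w) ^ 2 = 1 - sin (p * w) ^ 2" for w
    using sin_cos_squared_add[of "p * w"] by (simp add: algebra_simps)
  have step: "D = E"
    if "(F has_field_derivative D) (at w)" "(G has_field_derivative E) (at w)"
       "w \<in> -\<int>" "\<And>v. v \<in> -\<int> \<Longrightarrow> F v = G v" for F G :: "complex \<Rightarrow> complex" and D E w
    using DERIV_unique[OF has_field_derivative_transform_within_open[OF that(1) op that(3)]] that(2,4) by blast
  have 0: "Digamma (1 - w) - Digamma w = p * cos (p * w) / sin (p * w)" if "w \<in> -\<int>" for w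
    using Digamma_reflection_complex[of w] that by (simp add: p_def)
  have 1: "Polygamma 1 w + Polygamma 1 (1 - w) = p ^ 2 / sin (p * w) ^ 2" if w: "w \<in> -\<int>" for w
  proof -
    have "((\<lambda>w. Digamma (1 - w) - Digamma w) has_field_derivative
            - (Polygamma 1 w + Polygamma 1 (1 - w))) (at w)"
      by (rule derivative_eq_intros refl nz[OF w] | simp)+
    moreover have "((\<lambda>w. p * cos (p * w) / sin (p * w)) has_field_derivative
                      - (p ^ 2 / sin (p * w) ^ 2)) (at w)"
      apply (rule derivative_eq_intros refl s0[OF w])+
      using s0[OF w] sc[of w] apply (simp add: divide_simps power2_eq_square)
      apply algebra
      done
    ultimately have "- (Polygamma 1 w + Polygamma 1 (1 - w)) = - (p ^ 2 / sin (p * w) ^ 2)"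
      by (rule step[OF _ _ w 0])
    thus ?thesis by (simp only: neg_equal_iff_equal)
  qed
  have 2: "Polygamma 2 w - Polygamma 2 (1 - w) = - (2 * p ^ 3 * cos (p * w) / sin (p * w) ^ 3)"
    if w: "w \<in> -\<int>" for w
  proof (rule step[OF _ _ w 1])
    show "((\<lambda>w. Polygamma 1 w + Polygamma 1 (1 - w)) has_field_derivative
            Polygamma 2 w - Polygamma 2 (1 - w)) (at w)"
      by (rule derivative_eq_intros refl nz[OF w] | simp add: numeral_2_eq_2)+
    show "((\<lambda>w. p ^ 2 / sin (p * w) ^ 2) has_field_derivative
            - (2 * p ^ 3 * cos (p * w) / sin (p * w) ^ 3)) (at w)"
      apply (rule derivative_eq_intros refl)+
      using s0[OF w] apply simp
      using s0[OF w] apply (simp add: divide_simps eval_nat_numeral)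
      done
  qed
  have 3: "Polygamma 3 w + Polygamma 3 (1 - w) = p ^ 4 * (6 / sin (p * w) ^ 4 - 4 / sin (p * w) ^ 2)"
    if w: "w \<in> -\<int>" for w
  proof (rule step[OF _ _ w 2])
    show "((\<lambda>w. Polygamma 2 w - Polygamma 2 (1 - w)) has_field_derivative
            Polygamma 3 w + Polygamma 3 (1 - w)) (at w)"
      by (rule derivative_eq_intros refl nz[OF w] | simp add: numeral_3_eq_3 numeral_2_eq_2)+
    show "((\<lambda>w. - (2 * p ^ 3 * cos (p * w) / sin (p * w) ^ 3)) has_field_derivative
            p ^ 4 * (6 / sin (p * w) ^ 4 - 4 / sin (p * w) ^ 2)) (at w)"
      apply (rule derivative_eq_intros refl)+
      using s0[OF w] apply simp
      apply (rule refl)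
      using s0[OF w] sc[of w] apply (simp add: divide_simps eval_nat_numeral)
      apply algebra
      done
  qed
  show ?thesis
    using 3[of z] assms by (simp add: p_def)
qed

lemma has_sum_int_split:
  fixes f :: "int \<Rightarrow> 'a :: {topological_ab_group_add, t2_space}"
  assumes "((\<lambda>k::nat. f (int k)) has_sum a) UNIV"
  assumes "((\<lambda>k::nat. f (-1 - int k)) has_sum b) UNIV"
  shows   "(f has_sum (a + b)) UNIV"
proof -
  have "(f has_sum a) {0..}"
    using assms(1) by (subst has_sum_reindex_bij_witness[of _ int nat UNIV "\<lambda>k. f (int k)"]) auto
  moreover have "(f has_sum b) {..<0}"
    using assms(2)
    by (subst has_sum_reindex_bij_witness[of _ "\<lambda>k. -1 - int k" "\<lambda>m. nat (-1 - m)" UNIV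
               "\<lambda>k. f (-1 - int k)"]) auto
  ultimately have "(f has_sum (a + b)) ({0..} \<union> {..<0})"
    by (rule has_sum_Un_disjoint) auto
  also have "{0..} \<union> {..<0} = (UNIV :: int set)" by auto
  finally show ?thesis .
qed

lemma summable_inverse_1_plus_square: "summable (\<lambda>k. 1 / (1 + real k ^ 2))"
proof (rule summable_comparison_test')
  show "summable (\<lambda>k. inverse (real k ^ 2))"
    by (rule inverse_power_summable) auto
  show "norm (1 / (1 + real k ^ 2)) \<le> inverse (real k ^ 2)" if "k \<ge> 1" for k
    using that by (auto simp: inverse_eq_divide intro!: divide_left_mono mult_pos_pos add_pos_nonneg)
qed

lemma summable_on_int_inverse_1_plus_square: "(\<lambda>m::int. 1 / (1 + real_of_int m ^ 2)) summable_on UNIV"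
proof -
  define s where "s = (\<Sum>k. 1 / (1 + real k ^ 2))"
  define s' where "s' = (\<Sum>k. 1 / (1 + real (Suc k) ^ 2))"
  have "((\<lambda>k. 1 / (1 + real_of_int (int k) ^ 2)) has_sum s) UNIV"
    using summable_inverse_1_plus_square
    by (intro sums_nonneg_imp_has_sum) (auto simp: s_def summable_sums)
  moreover have "((\<lambda>k. 1 / (1 + real_of_int (-1 - int k) ^ 2)) has_sum s') UNIV"
  proof -
    have "summable (\<lambda>k. 1 / (1 + real (Suc k) ^ 2))"
      using summable_inverse_1_plus_square by (subst summable_Suc_iff)
    moreover have "(\<lambda>k. 1 / (1 + real_of_int (-1 - int k) ^ 2)) = (\<lambda>k. 1 / (1 + real (Suc k) ^ 2))"
      by (auto simp: fun_eq_iff power2_eq_square algebra_simps)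
    ultimately show ?thesis
      by (intro sums_nonneg_imp_has_sum) (auto simp: s'_def summable_sums)
  qed
  ultimately show ?thesis
    using has_sum_int_split[of "\<lambda>m. 1 / (1 + real_of_int m ^ 2)"] has_sum_imp_summable by blast
qed

section \<open>Summation over the lattice\<close>

text \<open>
  The linear form \<open>m + n\<tau>\<close> dominates the Euclidean norm: its imaginary part controls \<open>n\<close>, and
  then its real part controls \<open>m\<close>. The bound has product form so that the double sum can be compared
  with a product of two simple sums; the origin needs no exception since there the term is
  \<open>1/0 = 0\<close>.
\<close>
lemma lattice_norm_bound:
  fixes \<tau> :: complex
  assumes "Im \<tau> > 0"
  obtains C where
    "\<And>m n :: int. norm (1 / (of_int m + of_int n * \<tau>) ^ 4) \<le> C * (1 / (1 + real_of_int n ^ 2) * (1 / (1 + real_of_int m ^ 2)))"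
proof -
  \<comment> \<open>From \<open>\<bar>n\<bar> \<le> N / Im \<tau>\<close> and \<open>\<bar>m\<bar> \<le> N + \<bar>n\<bar> \<bar>\<tau>\<bar>\<close> with \<open>N = \<bar>m + n\<tau>\<bar>\<close>.\<close>
  define K where "K = (1 + norm \<tau> / Im \<tau>) ^ 2 + (1 / Im \<tau>) ^ 2"
  have K: "real_of_int m ^ 2 + real_of_int n ^ 2 \<le> K * norm (of_int m + of_int n * \<tau>) ^ 2" for m n
  proof -
    define N where "N = norm (of_int m + of_int n * \<tau>)"
    have "\<bar>Im (of_int m + of_int n * \<tau>)\<bar> \<le> N"
      unfolding N_def by (rule abs_Im_le_cmod)
    hence "\<bar>real_of_int n\<bar> * Im \<tau> \<le> N"
      using assms by (simp add: abs_mult)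
    hence n: "\<bar>real_of_int n\<bar> \<le> 1 / Im \<tau> * N"
      using assms by (simp add: field_simps)
    have "norm (of_int m :: complex) \<le> N + norm (of_int n * \<tau>)"
      unfolding N_def using norm_triangle_ineq4[of "of_int m + of_int n * \<tau>" "of_int n * \<tau>"] by simp
    also have "norm (of_int n * \<tau>) = \<bar>real_of_int n\<bar> * norm \<tau>"
      by (simp add: norm_mult)
    also have "\<dots> \<le> 1 / Im \<tau> * N * norm \<tau>"
      by (intro mult_right_mono n) auto
    finally have m: "\<bar>real_of_int m\<bar> \<le> (1 + norm \<tau> / Im \<tau>) * N"
      by (simp add: algebra_simps)
    have "\<bar>real_of_int m\<bar> ^ 2 + \<bar>real_of_int n\<bar> ^ 2 \<le> ((1 + norm \<tau> / Im \<tau>) * N) ^ 2 + (1 / Im \<tau> * N) ^ 2"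
      using m n by (intro add_mono power_mono) auto
    also have "\<dots> = K * N ^ 2"
      unfolding K_def power_mult_distrib by (simp only: distrib_right)
    finally show ?thesis by (simp add: N_def)
  qed
  have "norm (1 / (of_int m + of_int n * \<tau>) ^ 4) \<le>
          4 * K ^ 2 * (1 / (1 + real_of_int n ^ 2) * (1 / (1 + real_of_int m ^ 2)))" for m n
  proof (cases "m = 0 \<and> n = 0")
    case False
    define s where "s = real_of_int m ^ 2 + real_of_int n ^ 2"
    define N where "N = norm (of_int m + of_int n * \<tau>)"
    have "of_int m + of_int n * \<tau> \<noteq> 0"
      using False assms by (auto simp: complex_eq_iff)
    hence N: "N > 0" by (simp add: N_def)
    have "m ^ 2 + n ^ 2 \<noteq> 0"
      using False by (simp add: sum_power2_eq_zero_iff)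
    moreover have "m ^ 2 + n ^ 2 \<ge> 0" by simp
    ultimately have "m ^ 2 + n ^ 2 \<ge> 1" by linarith
    hence "real_of_int (m ^ 2 + n ^ 2) \<ge> 1" by linarith
    hence s: "s \<ge> 1" by (simp add: s_def)
    have "(1 + real_of_int n ^ 2) * (1 + real_of_int m ^ 2) \<le> (2 * s) * (2 * s)"
    proof (intro mult_mono)
      have "real_of_int n ^ 2 \<le> s" "real_of_int m ^ 2 \<le> s" by (auto simp: s_def)
      thus "1 + real_of_int n ^ 2 \<le> 2 * s" "1 + real_of_int m ^ 2 \<le> 2 * s"
        using s by simp_all
    qed (use s in auto)
    also have "\<dots> = 4 * s ^ 2" by (simp add: power2_eq_square)
    also have "\<dots> \<le> 4 * (K * N ^ 2) ^ 2"
      using K[of m n] s by (intro mult_left_mono power_mono) (auto simp: s_def N_def)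
    also have "\<dots> = 4 * K ^ 2 * N ^ 4"
      by (simp add: power_mult_distrib)
    finally have "(1 + real_of_int n ^ 2) * (1 + real_of_int m ^ 2) \<le> 4 * K ^ 2 * N ^ 4" .
    moreover have "1 + real_of_int n ^ 2 > 0" "1 + real_of_int m ^ 2 > 0"
      by (auto simp: add_pos_nonneg)
    moreover have "1 / M \<le> c * (1 / a * (1 / b))" if "a * b \<le> c * M" "a > 0" "b > 0" "M > 0" for a b c M :: real
      using that by (simp add: field_simps)
    ultimately have "1 / N ^ 4 \<le> 4 * K ^ 2 * (1 / (1 + real_of_int n ^ 2) * (1 / (1 + real_of_int m ^ 2)))"
      using N by simp
    thus ?thesis by (simp add: N_def norm_divide norm_power)
  qed auto
  thus thesis by (rule that)
qed

lemma abs_summable_lattice: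
  fixes \<tau> :: complex
  assumes "Im \<tau> > 0"
  shows "(\<lambda>p. norm (case p of (n :: int, m :: int) \<Rightarrow> 1 / (of_int m + of_int n * \<tau>) ^ 4)) summable_on UNIV"
proof -
  obtain C where C: "\<And>m n :: int. norm (1 / (of_int m + of_int n * \<tau>) ^ 4) \<le>
                       C * (1 / (1 + real_of_int n ^ 2) * (1 / (1 + real_of_int m ^ 2)))"
    using lattice_norm_bound[OF assms] by metis
  obtain s where s: "((\<lambda>m::int. 1 / (1 + real_of_int m ^ 2)) has_sum s) UNIV"
    using summable_on_int_inverse_1_plus_square by (auto simp: summable_on_def)
  have "(\<lambda>(n, m). 1 / (1 + real_of_int n ^ 2) * (1 / (1 + real_of_int m ^ 2))) summable_on (UNIV \<times> UNIV)"
  proof (rule summable_on_SigmaI)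
    show "((\<lambda>m. case (n, m) of (n, m) \<Rightarrow> 1 / (1 + real_of_int n ^ 2) * (1 / (1 + real_of_int m ^ 2)))
             has_sum 1 / (1 + real_of_int n ^ 2) * s) UNIV" for n :: int
      using has_sum_cmult_right[OF s, of "1 / (1 + real_of_int n ^ 2)"] by simp
    show "(\<lambda>n::int. 1 / (1 + real_of_int n ^ 2) * s) summable_on UNIV"
      by (intro summable_on_cmult_left summable_on_int_inverse_1_plus_square)
  qed auto
  hence "(\<lambda>x. C * (case x of (n, m) \<Rightarrow> 1 / (1 + real_of_int n ^ 2) * (1 / (1 + real_of_int m ^ 2)))) summable_on UNIV"
    by (intro summable_on_cmult_right) simp
  thus ?thesis
    by (rule summable_on_comparison_test) (use C in auto)
qed

lemma polygamma_3_has_sum: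
  fixes z :: complex
  assumes "summable (\<lambda>k. norm (1 / (z + of_nat k) ^ 4))" "z \<noteq> 0"
  shows "((\<lambda>k. 1 / (z + of_nat k) ^ 4) has_sum Polygamma 3 z / 6) UNIV"
proof (rule norm_summable_imp_has_sum)
  show "(\<lambda>k. 1 / (z + of_nat k) ^ 4) sums (Polygamma 3 z / 6)"
    using Polygamma_LIMSEQ[of z 3] assms(2) by (simp add: inverse_eq_divide fact_numeral)
qed (use assms in auto)

lemma has_sum_inverse_fourth_powers:
  fixes z :: complex
  assumes "Im z > 0"
  shows "((\<lambda>m::int. 1 / (of_int m + z) ^ 4) has_sum
           of_real pi ^ 4 * (1 / sin (of_real pi * z) ^ 4 - 2 / (3 * sin (of_real pi * z) ^ 2))) UNIV"
proof -
  have zZ: "z \<notin> \<int>" using assms by (auto simp: Ints_def)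
  obtain C where C: "\<And>m n :: int. norm (1 / (of_int m + of_int n * z) ^ 4) \<le>
                       C * (1 / (1 + real_of_int n ^ 2) * (1 / (1 + real_of_int m ^ 2)))"
    using lattice_norm_bound[OF assms] by metis
  have C': "norm (1 / (of_int m + z) ^ 4) \<le> C / 2 * (1 / (1 + real_of_int m ^ 2))" for m
    using C[of m 1] by simp
  have "((\<lambda>k. 1 / (z + of_nat k) ^ 4) has_sum Polygamma 3 z / 6) UNIV"
  proof (rule polygamma_3_has_sum)
    show "summable (\<lambda>k. norm (1 / (z + of_nat k) ^ 4))"
    proof (rule summable_comparison_test')
      show "summable (\<lambda>k. C / 2 * (1 / (1 + real k ^ 2)))"
        by (intro summable_mult summable_inverse_1_plus_square)
      show "norm (norm (1 / (z + of_nat k) ^ 4)) \<le> C / 2 * (1 / (1 + real k ^ 2))" for k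
        using C'[of "int k"] by (simp add: add.commute)
    qed
  qed (use assms in auto)
  moreover have "((\<lambda>k. 1 / (1 - z + of_nat k) ^ 4) has_sum Polygamma 3 (1 - z) / 6) UNIV"
  proof (rule polygamma_3_has_sum)
    show "summable (\<lambda>k. norm (1 / (1 - z + of_nat k) ^ 4))"
    proof (rule summable_comparison_test')
      show "summable (\<lambda>k. C / 2 * (1 / (1 + real (Suc k) ^ 2)))"
        using summable_inverse_1_plus_square by (intro summable_mult) (subst summable_Suc_iff)
      show "norm (norm (1 / (1 - z + of_nat k) ^ 4)) \<le> C / 2 * (1 / (1 + real (Suc k) ^ 2))" for k
      proof -
        have "(1 - z + of_nat k) ^ 4 = (-(1 - z + of_nat k)) ^ 4"
          by (rule power_minus_even [symmetric]) simp
        also have "-(1 - z + of_nat k) = of_int (- 1 - int k) + z" by simp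
        finally show ?thesis using C'[of "- 1 - int k"] by (simp add: power2_eq_square algebra_simps)
      qed
    qed
  qed (use assms in \<open>auto simp: complex_eq_iff\<close>)
  ultimately have "((\<lambda>m::int. 1 / (of_int m + z) ^ 4) has_sum Polygamma 3 z / 6 + Polygamma 3 (1 - z) / 6) UNIV"
  proof (intro has_sum_int_split, goal_cases)
    case 1 thus ?case by (simp add: add.commute)
  next
    case 2
    have "(of_int (- 1 - int k) + z) ^ 4 = (1 - z + of_nat k) ^ 4" for k
    proof -
      have "(of_int (- 1 - int k) + z) ^ 4 = (-(of_int (- 1 - int k) + z)) ^ 4"
        by (rule power_minus_even [symmetric]) simp
      also have "-(of_int (- 1 - int k) + z) = 1 - z + of_nat k" by simp
      finally show ?thesis .
    qed
    with 2 show ?case by simp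
  qed
  also have "Polygamma 3 z / 6 + Polygamma 3 (1 - z) / 6 = (Polygamma 3 z + Polygamma 3 (1 - z)) / 6"
    by (simp add: add_divide_distrib)
  also have "\<dots> = of_real pi ^ 4 * (1 / sin (of_real pi * z) ^ 4 - 2 / (3 * sin (of_real pi * z) ^ 2))"
    unfolding Polygamma_3_reflection_complex[OF zZ] by (simp add: field_simps)
  finally show ?thesis .
qed

text \<open>
  At \<open>z = 1/2\<close> the reflection formula evaluates the sum over the odd numbers, which is
  \<open>15/16\<close> of the full sum.
\<close>
lemma zeta_4: "(\<lambda>k. 1 / real (Suc k) ^ 4) sums (pi ^ 4 / 90)"
proof -
  have "Polygamma 3 (1 / 2 :: complex) + Polygamma 3 (1 - 1 / 2) = of_real pi ^ 4 * 2"
  proof -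
    have "(1 / 2 :: complex) \<notin> \<int>"
      using fraction_not_in_Ints[of 2 1, where ?'a = complex] by simp
    moreover have "sin (of_real pi * (1 / 2 :: complex)) = 1"
    proof -
      have "of_real pi * (1 / 2 :: complex) = of_real (pi / 2)" by simp
      thus ?thesis by (simp only: sin_of_real sin_pi_half of_real_1)
    qed
    ultimately show ?thesis
      using Polygamma_3_reflection_complex[of "1/2"] by (simp only:) simp
  qed
  hence "Polygamma 3 (of_real (1/2) :: complex) = of_real (pi ^ 4)" by simp
  hence half: "Polygamma 3 (1 / 2 :: real) = pi ^ 4"
    by (subst (asm) Polygamma_of_real) (auto simp del: of_real_divide of_real_power)
  have "(\<lambda>k. inverse ((1 / 2 + real k) ^ 4)) sums (pi ^ 4 / 6)"
    using Polygamma_LIMSEQ[of "1 / 2 :: real" 3] half by (simp add: fact_numeral)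
  hence "(\<lambda>k. 1 / 16 * inverse ((1 / 2 + real k) ^ 4)) sums (1 / 16 * (pi ^ 4 / 6))"
    by (rule sums_mult)
  also have "(\<lambda>k. 1 / 16 * inverse ((1 / 2 + real k) ^ 4)) = (\<lambda>k. 1 / (2 * real k + 1) ^ 4)"
  proof
    fix k :: nat
    have "(2 * real k + 1) ^ 4 = (2 * (1 / 2 + real k)) ^ 4" by (simp add: algebra_simps)
    also have "\<dots> = 16 * (1 / 2 + real k) ^ 4" by (simp only: power_mult_distrib) simp
    finally show "1 / 16 * inverse ((1 / 2 + real k) ^ 4) = 1 / (2 * real k + 1) ^ 4"
      by (simp add: field_simps)
  qed
  finally have odd: "(\<lambda>k. 1 / (2 * real k + 1) ^ 4) sums (pi ^ 4 / 96)" by simp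
  have "summable (\<lambda>k. inverse (real k ^ 4))"
    by (rule inverse_power_summable) auto
  hence "summable (\<lambda>k. inverse (real (Suc k) ^ 4))"
    by (subst summable_Suc_iff)
  then obtain Z where Z: "(\<lambda>k. 1 / real (Suc k) ^ 4) sums Z"
    by (auto simp: summable_def inverse_eq_divide)
  have "(\<lambda>k. \<Sum>i=k*2..<k*2+2. 1 / real (Suc i) ^ 4) sums Z"
    by (rule sums_group[OF Z]) auto
  also have "(\<lambda>k. \<Sum>i=k*2..<k*2+2. 1 / real (Suc i) ^ 4) =
             (\<lambda>k. 1 / (2 * real k + 1) ^ 4 + 1 / 16 * (1 / real (Suc k) ^ 4))"
  proof
    fix k :: nat
    have "{k*2..<k*2+2} = {2*k, 2*k+1}" by auto
    moreover have "(2 * real k + 2) ^ 4 = 16 * (real k + 1) ^ 4"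
    proof -
      have "(2 * real k + 2) ^ 4 = (2 * (real k + 1)) ^ 4" by (simp add: algebra_simps)
      thus ?thesis by (simp only: power_mult_distrib) simp
    qed
    ultimately show "(\<Sum>i=k*2..<k*2+2. 1 / real (Suc i) ^ 4) =
                       1 / (2 * real k + 1) ^ 4 + 1 / 16 * (1 / real (Suc k) ^ 4)"
      by (simp add: add_ac)
  qed
  finally have "(\<lambda>k. 1 / (2 * real k + 1) ^ 4 + 1 / 16 * (1 / real (Suc k) ^ 4)) sums Z" .
  moreover have "(\<lambda>k. 1 / (2 * real k + 1) ^ 4 + 1 / 16 * (1 / real (Suc k) ^ 4)) sums (pi ^ 4 / 96 + 1 / 16 * Z)"
    by (intro sums_add sums_mult odd Z)
  ultimately have "Z = pi ^ 4 / 96 + 1 / 16 * Z" by (rule sums_unique2)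
  hence "Z = pi ^ 4 / 90" by simp
  with Z show ?thesis by simp
qed

section \<open>The Lipschitz formula and modularity of the Eisenstein series\<close>

lemma sums_times_index:
  fixes f :: "'a :: {real_normed_field, banach} \<Rightarrow> 'a"
  assumes "\<And>z. norm z < K \<Longrightarrow> (\<lambda>n. c n * z ^ n) sums f z"
  assumes "(f has_field_derivative f') (at z)" "norm z < K"
  shows   "(\<lambda>n. of_nat n * c n * z ^ n) sums (z * f')"
proof -
  have "(\<lambda>n. diffs c n * z ^ n) sums f'"
    by (rule termdiffs_sums_strong[OF assms])
  hence "(\<lambda>n. z * (diffs c n * z ^ n)) sums (z * f')"
    by (rule sums_mult)
  also have "(\<lambda>n. z * (diffs c n * z ^ n)) = (\<lambda>n. of_nat (Suc n) * c (Suc n) * z ^ Suc n)"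
    by (simp add: diffs_def fun_eq_iff mult_ac)
  finally show ?thesis
    using sums_Suc[of "\<lambda>n. of_nat n * c n * z ^ n"] by simp
qed

text \<open>
  The operator \<open>z d/dz\<close> applied three times to the geometric series.
\<close>
lemma cube_geometric_sums:
  fixes q :: "'a :: {real_normed_field, banach}"
  assumes "norm q < 1"
  shows "(\<lambda>k. of_nat k ^ 3 * q ^ k) sums (q * (1 + 4 * q + q ^ 2) / (1 - q) ^ 4)"
proof -
  have nz: "1 - z \<noteq> 0" if "norm z < 1" for z :: 'a
    using that by auto
  have 0: "(\<lambda>n. 1 * z ^ n) sums (1 / (1 - z))" if "norm z < 1" for z :: 'a
    using geometric_sums[OF that] by simp
  have 1: "(\<lambda>n. of_nat n * z ^ n) sums (z / (1 - z) ^ 2)" if "norm z < 1" for z :: 'a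
  proof -
    have "((\<lambda>z. 1 / (1 - z)) has_field_derivative 1 / (1 - z) ^ 2) (at z)"
      using nz[OF that] by (auto intro!: derivative_eq_intros simp: power2_eq_square divide_simps)
    from sums_times_index[OF 0 this that] show ?thesis by simp
  qed
  have 2: "(\<lambda>n. of_nat n ^ 2 * z ^ n) sums (z * (1 + z) / (1 - z) ^ 3)" if "norm z < 1" for z :: 'a
  proof -
    have "((\<lambda>z. z / (1 - z) ^ 2) has_field_derivative (1 + z) / (1 - z) ^ 3) (at z)"
      apply (rule derivative_eq_intros refl)+
      using nz[OF that] apply simp
      using nz[OF that] apply (simp add: divide_simps)
      apply algebra
      done
    from sums_times_index[OF 1 this that] show ?thesis by (simp add: power2_eq_square mult_ac)
  qed
  have "((\<lambda>z. z * (1 + z) / (1 - z) ^ 3) has_field_derivative (1 + 4 * q + q ^ 2) / (1 - q) ^ 4) (at q)"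
    apply (rule derivative_eq_intros refl)+
    using nz[OF assms] apply simp
    using nz[OF assms] apply (simp add: divide_simps)
    apply algebra
    done
  from sums_times_index[OF 2 this assms] show ?thesis by (simp add: eval_nat_numeral mult_ac)
qed

lemma sin_pi_squared_nome:
  fixes z :: complex
  defines "q \<equiv> exp (2 * of_real pi * \<i> * z)"
  shows "sin (of_real pi * z) ^ 2 = - ((1 - q) ^ 2 / (4 * q))"
proof -
  define e where "e = exp (\<i> * (of_real pi * z))"
  have e: "e \<noteq> 0" by (simp add: e_def)
  have q: "q = e ^ 2"
    by (simp add: q_def e_def exp_double [symmetric] mult_ac)
  have "sin (of_real pi * z) = (e - inverse e) / (2 * \<i>)"
    unfolding sin_exp_eq e_def by (simp add: exp_minus)
  hence "sin (of_real pi * z) ^ 2 = (e - inverse e) ^ 2 / (2 * \<i>) ^ 2"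
    by (simp only: power_divide)
  also have "(2 * \<i>) ^ 2 = - 4" by (simp add: power_mult_distrib)
  also have "(e - inverse e) ^ 2 / - 4 = - ((1 - e ^ 2) ^ 2 / (4 * e ^ 2))"
    using e by (simp add: divide_simps power2_eq_square) algebra
  finally show ?thesis by (simp add: q)
qed

lemma norm_nome_less_1: "Im z > 0 \<Longrightarrow> norm (exp (2 * of_real pi * \<i> * z)) < 1"
  by simp

text \<open>
  Both sides are rational functions of the nome \<open>q\<close>: the left-hand side through
  \<open>sin\<^sup>2(\<pi>z) = -(1 - q)\<^sup>2/(4q)\<close>, the right-hand side by \<open>cube_geometric_sums\<close>.
\<close>
lemma Lipschitz_formula_weight_4:
  fixes z :: complex
  defines "q \<equiv> exp (2 * of_real pi * \<i> * z)"
  assumes "Im z > 0"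
  shows "((\<lambda>m::int. 1 / (of_int m + z) ^ 4) has_sum
            8 * of_real pi ^ 4 / 3 * (\<Sum>k. of_nat k ^ 3 * q ^ k)) UNIV"
proof -
  have q1: "norm q < 1" unfolding q_def using assms(2) by (rule norm_nome_less_1)
  hence "q \<noteq> 1" by auto
  hence q: "q \<noteq> 0" "1 - q \<noteq> 0" by (auto simp: q_def)
  define s where "s = sin (of_real pi * z)"
  have s: "s ^ 2 = - ((1 - q) ^ 2 / (4 * q))"
    unfolding s_def q_def by (rule sin_pi_squared_nome)
  have "s ^ 4 = (s ^ 2) ^ 2" by simp
  also have "\<dots> = (1 - q) ^ 4 / (16 * q ^ 2)"
    unfolding s by (simp add: power_divide power_mult_distrib)
  finally have s4: "s ^ 4 = (1 - q) ^ 4 / (16 * q ^ 2)" .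
  have "1 / s ^ 4 - 2 / (3 * s ^ 2) = 8 / 3 * (q * (1 + 4 * q + q ^ 2) / (1 - q) ^ 4)"
    unfolding s s4 using q by (simp add: divide_simps) algebra
  also have "q * (1 + 4 * q + q ^ 2) / (1 - q) ^ 4 = (\<Sum>k. of_nat k ^ 3 * q ^ k)"
    using cube_geometric_sums[OF q1] by (simp add: sums_iff)
  finally have "of_real pi ^ 4 * (1 / s ^ 4 - 2 / (3 * s ^ 2)) =
                  8 * of_real pi ^ 4 / 3 * (\<Sum>k. of_nat k ^ 3 * q ^ k)"
    by simp
  with has_sum_inverse_fourth_powers[OF assms(2)] show ?thesis
    by (simp only: s_def)
qed

lemma has_sum_nat_shift:
  fixes f :: "nat \<Rightarrow> 'a :: {topological_ab_group_add, t2_space}"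
  assumes "((\<lambda>k. f (Suc k)) has_sum s) UNIV"
  shows   "(f has_sum (f 0 + s)) UNIV"
proof -
  have "(f has_sum s) (range Suc)"
    using assms by (subst has_sum_reindex) (auto simp: o_def)
  hence "(f has_sum (f 0 + s)) (insert 0 (range Suc))"
    by (intro has_sum_insert) auto
  also have "insert 0 (range Suc) = UNIV"
    using UNIV_nat_eq by auto
  finally show ?thesis .
qed

lemma has_sum_zeta_4_int:
  "((\<lambda>m::int. 1 / (of_int m :: complex) ^ 4) has_sum of_real pi ^ 4 / 45) UNIV"
proof -
  have "((\<lambda>k. 1 / (of_nat (Suc k) :: complex) ^ 4) has_sum of_real (pi ^ 4 / 90)) UNIV"
  proof (rule norm_summable_imp_has_sum)
    show "(\<lambda>k. 1 / (of_nat (Suc k) :: complex) ^ 4) sums of_real (pi ^ 4 / 90)"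
      using sums_of_real[OF zeta_4, where ?'a = complex] by simp
    have "norm (1 / (of_nat (Suc k) :: complex) ^ 4) = 1 / real (Suc k) ^ 4" for k
      unfolding norm_divide norm_power norm_of_nat by simp
    thus "summable (\<lambda>k. norm (1 / (of_nat (Suc k) :: complex) ^ 4))"
      using zeta_4 by (simp only: sums_iff)
  qed
  note Z = this
  have "((\<lambda>m::int. 1 / (of_int m :: complex) ^ 4) has_sum
           (of_real (pi ^ 4 / 90) + of_real (pi ^ 4 / 90))) UNIV"
  proof (rule has_sum_int_split)
    show "((\<lambda>k. 1 / (of_int (int k) :: complex) ^ 4) has_sum of_real (pi ^ 4 / 90)) UNIV"
      using has_sum_nat_shift[of "\<lambda>k. 1 / (of_nat k :: complex) ^ 4", OF Z] by simp
    have "(of_int (- 1 - int k) :: complex) ^ 4 = of_nat (Suc k) ^ 4" for k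
    proof -
      have "(of_int (- 1 - int k) :: complex) = - of_nat (Suc k)" by simp
      thus ?thesis by (simp only: power_minus_even[of 4] even_numeral)
    qed
    thus "((\<lambda>k. 1 / (of_int (- 1 - int k) :: complex) ^ 4) has_sum of_real (pi ^ 4 / 90)) UNIV"
      using Z by simp
  qed
  thus ?thesis by simp
qed

text \<open>
  Both series are rearrangements of the double series of \<open>k\<^sup>3 q\<^bsup>nk\<^esup>\<close> over \<open>n, k \<ge> 1\<close>: by rows,
  and by the value \<open>N = nk\<close>, where the index \<open>k\<close> runs through the divisors of \<open>N\<close>. Absolute convergence
  follows from \<open>nk \<ge> n + k - 1\<close>.
\<close>
lemma has_sum_Lambert_sigma3:
  fixes q :: complex
  assumes "norm q < 1" "q \<noteq> 0"
  obtains T where "((\<lambda>n. \<Sum>k. of_nat k ^ 3 * (q ^ Suc n) ^ k) has_sum T) UNIV"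
                  "((\<lambda>N. of_nat (sigma3 (Suc N)) * q ^ Suc N) has_sum T) UNIV"
proof -
  define x where "x = norm q"
  have x: "x < 1" "x > 0" using assms by (auto simp: x_def)
  define f where "f = (\<lambda>(n::nat, k::nat). of_nat k ^ 3 * q ^ (n * k))"
  have xs: "((\<lambda>k. real k ^ 3 * x ^ k) has_sum (x * (1 + 4 * x + x ^ 2) / (1 - x) ^ 4)) UNIV"
    using cube_geometric_sums[of x] x by (intro sums_nonneg_imp_has_sum) auto
  have xg: "((\<lambda>n. x ^ n) has_sum (1 / (1 - x))) UNIV"
    using geometric_sums[of x] x by (intro sums_nonneg_imp_has_sum) auto
  have "(\<lambda>(n, k). x ^ n * (real k ^ 3 * x ^ k)) summable_on (UNIV \<times> UNIV)"
  proof (rule summable_on_SigmaI)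
    show "((\<lambda>k. case (n, k) of (n, k) \<Rightarrow> x ^ n * (real k ^ 3 * x ^ k)) has_sum
            x ^ n * (x * (1 + 4 * x + x ^ 2) / (1 - x) ^ 4)) UNIV" for n
      using has_sum_cmult_right[OF xs, of "x ^ n"] by simp
    show "(\<lambda>n. x ^ n * (x * (1 + 4 * x + x ^ 2) / (1 - x) ^ 4)) summable_on UNIV"
      using has_sum_imp_summable[OF xg] by (rule summable_on_cmult_left)
  qed (use x in auto)
  hence "(\<lambda>(n, k). x ^ n * (real k ^ 3 * x ^ k)) summable_on ({1..} \<times> {1..})"
    by (rule summable_on_subset_banach) auto
  hence "(\<lambda>p. 1 / x * (case p of (n, k) \<Rightarrow> x ^ n * (real k ^ 3 * x ^ k))) summable_on ({1..} \<times> {1..})"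
    by (rule summable_on_cmult_right)
  hence "(\<lambda>p. norm (f p)) summable_on ({1..} \<times> {1..})"
  proof (rule summable_on_comparison_test)
    fix p :: "nat \<times> nat" assume "p \<in> {1..} \<times> {1..}"
    then obtain n k where p: "p = (Suc n, Suc k)"
      by (cases p) (auto simp: Suc_le_eq gr0_conv_Suc)
    have "x ^ (Suc n * Suc k) \<le> x ^ Suc (n + k)"
      using x by (intro power_decreasing) auto
    hence "real (Suc k) ^ 3 * x ^ (Suc n * Suc k) \<le> real (Suc k) ^ 3 * x ^ Suc (n + k)"
      by (intro mult_left_mono) auto
    also have "\<dots> = 1 / x * (x ^ Suc n * (real (Suc k) ^ 3 * x ^ Suc k))"
      using x by (simp add: field_simps power_add)
    finally show "norm (f p) \<le> 1 / x * (case p of (n, k) \<Rightarrow> x ^ n * (real k ^ 3 * x ^ k))"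
      unfolding f_def p prod.case norm_mult norm_power norm_of_nat x_def [symmetric] .
  qed auto
  hence "f summable_on ({1..} \<times> {1..})"
    by (rule abs_summable_summable)
  then obtain T where T: "(f has_sum T) ({1..} \<times> {1..})"
    by (auto simp: summable_on_def)
  have row: "((\<lambda>k. f (n, k)) has_sum (\<Sum>k. of_nat k ^ 3 * (q ^ n) ^ k)) {1..}" if "n \<in> {1..}" for n
  proof -
    have "norm (q ^ n) < 1"
      using that x by (simp add: norm_power x_def power_less_one_iff)
    hence "((\<lambda>k. of_nat k ^ 3 * (q ^ n) ^ k) has_sum (\<Sum>k. of_nat k ^ 3 * (q ^ n) ^ k)) UNIV"
      using cube_geometric_sums[of "q ^ n"] cube_geometric_sums[of "norm (q ^ n)"]
      by (intro norm_summable_imp_has_sum) (auto simp: norm_mult norm_power sums_iff)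
    hence "((\<lambda>k. of_nat k ^ 3 * (q ^ n) ^ k) has_sum (\<Sum>k. of_nat k ^ 3 * (q ^ n) ^ k)) {1..}"
      by (rule has_sum_cong_neutral [THEN iffD1, rotated -1]) (auto simp: not_le)
    thus ?thesis by (simp add: f_def power_mult)
  qed
  have "((\<lambda>n. \<Sum>k. of_nat k ^ 3 * (q ^ n) ^ k) has_sum T) {1..}"
    using has_sum_SigmaD[OF T row] by simp
  hence 1: "((\<lambda>n. \<Sum>k. of_nat k ^ 3 * (q ^ Suc n) ^ k) has_sum T) UNIV"
    by (subst has_sum_reindex_bij_witness[of _ "\<lambda>n. n - 1" Suc "{1..}"]) auto
  have "((\<lambda>(N, d). of_nat d ^ 3 * q ^ N) has_sum T) (SIGMA N:{1..}. {d. d dvd N})"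
    using T
    by (rule has_sum_reindex_bij_witness[of _ "\<lambda>(N, d). (N div d, d)" "\<lambda>(n, k). (n * k, k)", THEN iffD1, rotated -1])
       (auto simp: f_def Suc_le_eq elim!: dvdE)
  hence "((\<lambda>N. \<Sum>d | d dvd N. of_nat d ^ 3 * q ^ N) has_sum T) {1..}"
    by (rule has_sum_SigmaD) (auto intro!: has_sum_finiteI simp: Suc_le_eq)
  hence "((\<lambda>N. of_nat (sigma3 N) * q ^ N) has_sum T) {1..}"
    by (simp add: sigma3_def sum_distrib_right)
  hence 2: "((\<lambda>N. of_nat (sigma3 (Suc N)) * q ^ Suc N) has_sum T) UNIV"
    by (subst has_sum_reindex_bij_witness[of _ "\<lambda>n. n - 1" Suc "{1..}"]) auto
  from that 1 2 show thesis .
qed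

text \<open>
  The row \<open>n = 0\<close> contributes \<open>2 \<zeta>(4) = \<pi>\<^sup>4/45\<close>. The rows \<open>n\<close> and \<open>-n\<close> agree and are given by the
  Lipschitz formula at \<open>n\<tau>\<close>; together they contribute \<open>16\<pi>\<^sup>4/3 = 240 \<pi>\<^sup>4/45\<close> times the Lambert
  series. The term at the origin is \<open>1/0 = 0\<close>.
\<close>
lemma has_sum_lattice_E4:
  fixes \<tau> :: complex
  assumes "Im \<tau> > 0"
  shows "((\<lambda>(n::int, m::int). 1 / (of_int m + of_int n * \<tau>) ^ 4) has_sum (of_real pi ^ 4 / 45 * E4 \<tau>)) UNIV"
proof -
  define q where "q = exp (2 * of_real pi * \<i> * \<tau>)"
  define P where "P = 8 * complex_of_real pi ^ 4 / 3"
  define R where "R = (\<lambda>n::int. \<Sum>\<^sub>\<infinity>m::int. 1 / (of_int m + of_int n * \<tau>) ^ 4)"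
  have "norm q < 1" "q \<noteq> 0"
    using norm_nome_less_1[OF assms] by (auto simp: q_def)
  then obtain T where T: "((\<lambda>n. \<Sum>k. of_nat k ^ 3 * (q ^ Suc n) ^ k) has_sum T) UNIV"
                  "((\<lambda>N. of_nat (sigma3 (Suc N)) * q ^ Suc N) has_sum T) UNIV"
    by (rule has_sum_Lambert_sigma3)
  have E4: "E4 \<tau> = 1 + 240 * T"
    using has_sum_imp_sums[OF T(2)] by (simp add: E4_def q_def sums_iff)
  have "(\<lambda>(n::int, m::int). 1 / (of_int m + of_int n * \<tau>) ^ 4) summable_on UNIV"
    by (rule abs_summable_summable) (rule abs_summable_lattice[OF assms])
  then obtain G where G: "((\<lambda>(n::int, m::int). 1 / (of_int m + of_int n * \<tau>) ^ 4) has_sum G) (UNIV \<times> UNIV)"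
    by (auto simp: summable_on_def)
  have row0: "((\<lambda>m. 1 / (of_int m + of_int 0 * \<tau>) ^ 4) has_sum of_real pi ^ 4 / 45) UNIV"
    using has_sum_zeta_4_int by simp
  have rowp: "((\<lambda>m. 1 / (of_int m + of_int (int (Suc n)) * \<tau>) ^ 4) has_sum
                 P * (\<Sum>k. of_nat k ^ 3 * (q ^ Suc n) ^ k)) UNIV" for n
  proof -
    have "Im (of_int (int (Suc n)) * \<tau>) > 0" using assms by simp
    moreover have "exp (2 * of_real pi * \<i> * (of_int (int (Suc n)) * \<tau>)) = q ^ Suc n"
      unfolding q_def exp_of_nat_mult [symmetric] by (simp add: mult_ac)
    ultimately show ?thesis
      using Lipschitz_formula_weight_4[of "of_int (int (Suc n)) * \<tau>"] by (simp only: P_def)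
  qed
  have rown: "((\<lambda>m. 1 / (of_int m + of_int (- 1 - int n) * \<tau>) ^ 4) has_sum
                 P * (\<Sum>k. of_nat k ^ 3 * (q ^ Suc n) ^ k)) UNIV" for n
  proof (rule has_sum_reindex_bij_witness[of _ uminus uminus, THEN iffD1, OF _ _ _ _ _ _ rowp])
    show "1 / (of_int (- m) + of_int (- 1 - int n) * \<tau>) ^ 4 =
            1 / (of_int m + of_int (int (Suc n)) * \<tau>) ^ 4" for m
    proof -
      have "of_int (- m) + of_int (- 1 - int n) * \<tau> = - (of_int m + of_int (int (Suc n)) * \<tau>)"
        by (simp add: algebra_simps)
      thus ?thesis by (simp only: power_minus_even even_numeral)
    qed
  qed auto
  have "((\<lambda>n. R (int n)) has_sum (R (int 0) + P * T)) UNIV"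
    using has_sum_cmult_right[OF T(1), of P]
    by (intro has_sum_nat_shift) (simp only: R_def infsumI[OF rowp])
  moreover have "((\<lambda>n. R (- 1 - int n)) has_sum (P * T)) UNIV"
    using has_sum_cmult_right[OF T(1), of P]
    by (simp only: R_def infsumI[OF rown])
  ultimately have "(R has_sum (R (int 0) + P * T + P * T)) UNIV"
    by (rule has_sum_int_split)
  also have "R (int 0) = of_real pi ^ 4 / 45"
    using infsumI[OF row0] by (simp add: R_def)
  also have "of_real pi ^ 4 / 45 + P * T + P * T = of_real pi ^ 4 / 45 * E4 \<tau>"
    by (simp add: P_def E4 field_simps)
  finally have "(R has_sum (of_real pi ^ 4 / 45 * E4 \<tau>)) UNIV" .
  moreover have "(R has_sum G) UNIV"
  proof (rule has_sum_SigmaD[OF G])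
    fix n :: int
    have "(\<lambda>m. 1 / (of_int m + of_int n * \<tau>) ^ 4) summable_on UNIV"
      using summable_on_SigmaD1[of "\<lambda>n m. 1 / (of_int m + of_int n * \<tau>) ^ 4" UNIV "\<lambda>_. UNIV" n] G
      by (auto simp: summable_on_def)
    thus "((\<lambda>m. case (n, m) of (n, m) \<Rightarrow> 1 / (of_int m + of_int n * \<tau>) ^ 4) has_sum R n) UNIV"
      unfolding R_def by simp
  qed
  ultimately have "G = of_real pi ^ 4 / 45 * E4 \<tau>"
    using has_sum_unique by blast
  with G show ?thesis by simp
qed

text \<open>
  From \<open>m + n (-1/\<tau>) = (m\<tau> - n)/\<tau>\<close>, the inversion permutes the terms of the lattice sum up to the
  factor \<open>\<tau>\<^sup>4\<close>.
\<close>
theorem E4_minus_inverse: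
  assumes "Im \<tau> > 0"
  shows "E4 (- 1 / \<tau>) = \<tau> ^ 4 * E4 \<tau>"
proof -
  have \<tau>: "\<tau> \<noteq> 0" using assms by auto
  have "Im (- 1 / \<tau>) > 0"
    using assms by (simp add: Im_divide_Reals Im_divide power2_eq_square divide_pos_pos add_nonneg_pos)
  hence "((\<lambda>(n::int, m::int). 1 / (of_int m + of_int n * (- 1 / \<tau>)) ^ 4) has_sum
            (of_real pi ^ 4 / 45 * E4 (- 1 / \<tau>))) UNIV"
    by (rule has_sum_lattice_E4)
  moreover have "((\<lambda>(n::int, m::int). 1 / (of_int m + of_int n * (- 1 / \<tau>)) ^ 4) has_sum
            (\<tau> ^ 4 * (of_real pi ^ 4 / 45 * E4 \<tau>))) UNIV"
  proof (rule has_sum_reindex_bij_witness[of _ "\<lambda>(n, m). (m, - n)" "\<lambda>(n, m). (- m, n)", THEN iffD1,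
               OF _ _ _ _ _ _ has_sum_cmult_right[OF has_sum_lattice_E4[OF assms], of "\<tau> ^ 4"]])
    fix p :: "int \<times> int"
    obtain n m where p: "p = (n, m)" by (cases p)
    have "of_int n + of_int (- m) * (- 1 / \<tau>) = (of_int m + of_int n * \<tau>) / \<tau>"
      using \<tau> by (simp add: field_simps)
    hence "1 / (of_int n + of_int (- m) * (- 1 / \<tau>)) ^ 4 = \<tau> ^ 4 * (1 / (of_int m + of_int n * \<tau>) ^ 4)"
      by (simp add: power_divide)
    thus "(case (case p of (n, m) \<Rightarrow> (- m, n)) of (n, m) \<Rightarrow> 1 / (of_int m + of_int n * (- 1 / \<tau>)) ^ 4) =
            \<tau> ^ 4 * (case p of (n, m) \<Rightarrow> 1 / (of_int m + of_int n * \<tau>) ^ 4)"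
      by (simp only: p prod.case)
  qed auto
  ultimately have "of_real pi ^ 4 / 45 * E4 (- 1 / \<tau>) = \<tau> ^ 4 * (of_real pi ^ 4 / 45 * E4 \<tau>)"
    by (rule has_sum_unique)
  thus ?thesis by simp
qed

section \<open>The Frobenius solution\<close>

fun frob_coeff :: "nat \<Rightarrow> nat \<Rightarrow> real" where
  "frob_coeff r 0 = 1"
| "frob_coeff r (Suc n) =
     60 * real r ^ 2 / (real (Suc n) * real (Suc n + r)) *
       (\<Sum>k\<le>n. real (sigma3 (Suc n - k)) * frob_coeff r k)"

text \<open>
  This sign property is what later separates the solution from its image under the inversion.
\<close>
lemma frob_coeff_nonneg: "frob_coeff r n \<ge> 0"
  by (induction r n rule: frob_coeff.induct)
     (auto intro!: mult_nonneg_nonneg divide_nonneg_nonneg sum_nonneg)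

lemma sigma3_0 [simp]: "sigma3 0 = 0"
  by (simp add: sigma3_def)

text \<open>
  The Frobenius recursion. Substituting \<open>q\<^bsup>r/2\<^esup> \<Sum> a\<^sub>n q\<^sup>n\<close> into \<open>f'' = - \<pi>\<^sup>2 r\<^sup>2 E\<^sub>4 f\<close> and using
  \<open>d/d\<tau> = 2\<pi>\<i> q d/dq\<close> gives \<open>4 ((n + r/2)\<^sup>2 - r\<^sup>2/4) a\<^sub>n\<close>, that is \<open>4 n (n + r) a\<^sub>n\<close>, on the left and \<open>240 r\<^sup>2\<close> times
  the sum on the right, whose summand \<open>k = n\<close> vanishes.
\<close>
lemma frob_coeff_rec:
  "real n * real (n + r) * frob_coeff r n =
     60 * real r ^ 2 * (\<Sum>k\<le>n. real (sigma3 (n - k)) * frob_coeff r k)"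
proof (cases n)
  case (Suc m)
  have "(\<Sum>k\<le>n. real (sigma3 (n - k)) * frob_coeff r k) = (\<Sum>k\<le>m. real (sigma3 (n - k)) * frob_coeff r k)"
    by (simp add: Suc)
  thus ?thesis by (simp add: Suc field_simps del: of_nat_Suc of_nat_add)
qed auto

lemma summable_sigma3_power:
  fixes q :: complex
  assumes "norm q < 1"
  shows "summable (\<lambda>n. of_nat (sigma3 n) * q ^ n)"
proof (cases "q = 0")
  case False
  obtain T where "((\<lambda>N. of_nat (sigma3 (Suc N)) * q ^ Suc N) has_sum T) UNIV"
    using has_sum_Lambert_sigma3[OF assms False] by blast
  hence "summable (\<lambda>N. of_nat (sigma3 (Suc N)) * q ^ Suc N)"
    using has_sum_imp_sums by (auto simp: summable_def)
  thus ?thesis by (subst (asm) summable_Suc_iff)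
qed (auto intro!: summable_finite[of "{0}"])

text \<open>
  In the recursion for \<open>a\<^sub>n R\<^sup>n\<close> the sum is at most \<open>s\<close> times the maximum of the previous terms, where
  \<open>s = \<Sum> \<sigma>\<^sub>3(n) R\<^sup>n\<close>, and the factor \<open>n (n + r)\<close> on the left beats \<open>60 r\<^sup>2 s\<close> from some index on; from
  there on the maximum cannot grow.
\<close>
lemma frob_coeff_bounded:
  assumes "0 < R" "R < 1"
  obtains K where "\<And>n. frob_coeff r n * R ^ n \<le> K"
proof -
  define s where "s = (\<Sum>n. real (sigma3 n) * R ^ n)"
  have "summable (\<lambda>n. complex_of_real (real (sigma3 n) * R ^ n))"
    using summable_sigma3_power[of "of_real R"] assms by simp
  hence summ: "summable (\<lambda>n. real (sigma3 n) * R ^ n)"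
    by (subst (asm) summable_of_real_iff)
  have s: "(\<Sum>n\<in>A. real (sigma3 n) * R ^ n) \<le> s" if "finite A" for A
    unfolding s_def using assms that by (intro sum_le_suminf summ) auto
  have s0: "s \<ge> 0" using s[of "{}"] by simp
  define b where "b = (\<lambda>n. frob_coeff r n * R ^ n)"
  have b0: "b n \<ge> 0" for n
    using assms frob_coeff_nonneg by (simp add: b_def)
  obtain N0 :: nat where "real N0 \<ge> 60 * real r ^ 2 * s"
    using real_arch_simple by blast
  define N where "N = Suc N0"
  have N: "60 * real r ^ 2 * s \<le> real N ^ 2"
  proof -
    have "60 * real r ^ 2 * s \<le> real N" using \<open>real N0 \<ge> _\<close> by (simp add: N_def)
    also have "real N * 1 \<le> real N * real N" unfolding N_def by (intro mult_left_mono) auto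
    finally show ?thesis by (simp add: power2_eq_square)
  qed
  define K where "K = Max (b ` {..N})"
  have K: "b n \<le> K" if "n \<le> N" for n
    unfolding K_def using that by (intro Max_ge) auto
  have K0: "K \<ge> 0" using K[of 0] b0[of 0] by simp
  have "b n \<le> K" for n
  proof (induction n rule: less_induct)
    case (less n)
    show ?case
    proof (cases "n \<le> N")
      case False
      have "real n ^ 2 * b n \<le> real n * real (n + r) * b n"
        using b0[of n] by (intro mult_right_mono) (auto simp: power2_eq_square algebra_simps)
      also have "\<dots> = R ^ n * (real n * real (n + r) * frob_coeff r n)"
        by (simp add: b_def)
      also have "\<dots> = 60 * real r ^ 2 * (\<Sum>k\<le>n. real (sigma3 (n - k)) * R ^ (n - k) * b k)"
        unfolding frob_coeff_rec sum_distrib_left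
        by (intro sum.cong refl) (auto simp: b_def mult_ac simp flip: power_add)
      finally have rec: "real n ^ 2 * b n \<le>
          60 * real r ^ 2 * (\<Sum>k\<le>n. real (sigma3 (n - k)) * R ^ (n - k) * b k)" .
      have "(\<Sum>k\<le>n. real (sigma3 (n - k)) * R ^ (n - k) * b k) \<le>
                 (\<Sum>k\<le>n. real (sigma3 (n - k)) * R ^ (n - k) * K)"
      proof (intro sum_mono)
        fix k assume "k \<in> {..n}"
        show "real (sigma3 (n - k)) * R ^ (n - k) * b k \<le> real (sigma3 (n - k)) * R ^ (n - k) * K"
          using less.IH[of k] assms \<open>k \<in> {..n}\<close>
          by (cases "k = n") (auto intro!: mult_left_mono)
      qed
      also have "\<dots> = (\<Sum>k\<le>n. real (sigma3 k) * R ^ k) * K"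
        unfolding sum_distrib_right
        by (rule sum.reindex_bij_witness[of _ "\<lambda>k. n - k" "\<lambda>k. n - k"]) auto
      also have "\<dots> \<le> s * K"
        using K0 s by (intro mult_right_mono) auto
      finally have "60 * real r ^ 2 * (\<Sum>k\<le>n. real (sigma3 (n - k)) * R ^ (n - k) * b k) \<le>
                    60 * real r ^ 2 * (s * K)"
        by (intro mult_left_mono) auto
      with rec have "real n ^ 2 * b n \<le> 60 * real r ^ 2 * (s * K)"
        by (rule order_trans)
      also have "60 * real r ^ 2 * (s * K) \<le> real N ^ 2 * K"
        using mult_right_mono[OF N K0] by (simp add: mult_ac)
      also have "\<dots> \<le> real n ^ 2 * K"
        using False K0 by (intro mult_right_mono power_mono) auto
      finally show ?thesis using False by (subst (asm) mult_le_cancel_left_pos) auto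
    qed (use K in auto)
  qed
  with that show thesis by (auto simp: b_def)
qed

lemma summable_frob_coeff:
  assumes "0 \<le> x" "x < 1"
  shows "summable (\<lambda>n. frob_coeff r n * x ^ n)"
proof -
  obtain R where R: "x < R" "R < 1" using assms dense by blast
  with assms have "0 < R" by simp
  then obtain K where K: "\<And>n. frob_coeff r n * R ^ n \<le> K"
    using frob_coeff_bounded R by blast
  have "summable (\<lambda>n. norm (frob_coeff r n) * x ^ n)"
    by (rule Abel_lemma[of _ R _ K]) (use K R assms frob_coeff_nonneg in auto)
  thus ?thesis by (simp add: frob_coeff_nonneg)
qed

definition frob_fps :: "nat \<Rightarrow> complex fps" where
  "frob_fps r = Abs_fps (\<lambda>n. of_real (frob_coeff r n))"

lemma frob_fps_conv_radius: "fps_conv_radius (frob_fps r) \<ge> 1"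
  unfolding fps_conv_radius_def
proof (rule conv_radius_geI_ex')
  fix x :: real assume x: "0 < x" "ereal x < 1"
  hence "summable (\<lambda>n. complex_of_real (frob_coeff r n * x ^ n))"
    by (subst summable_of_real_iff) (intro summable_frob_coeff, auto)
  thus "summable (\<lambda>n. fps_nth (frob_fps r) n * of_real x ^ n)"
    by (simp add: frob_fps_def)
qed

lemma frob_fps_sums:
  assumes "norm q < 1"
  shows "(\<lambda>n. of_real (frob_coeff r n) * q ^ n) sums eval_fps (frob_fps r) q"
proof -
  have "ereal (norm q) < fps_conv_radius (frob_fps r)"
    using assms frob_fps_conv_radius[of r] by (metis ereal_less(3) less_le_trans)
  hence "summable (\<lambda>n. fps_nth (frob_fps r) n * q ^ n)"
    unfolding fps_conv_radius_def by (rule summable_in_conv_radius)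
  thus ?thesis
    unfolding eval_fps_def by (simp add: frob_fps_def summable_sums)
qed

lemma frob_fps_derivs:
  fixes q :: complex
  assumes "norm q < 1"
  shows "(eval_fps (frob_fps r) has_field_derivative eval_fps (fps_deriv (frob_fps r)) q) (at q)"
    and "(eval_fps (fps_deriv (frob_fps r)) has_field_derivative
            eval_fps (fps_deriv (fps_deriv (frob_fps r))) q) (at q)"
proof -
  have 1: "ereal (norm q) < fps_conv_radius (frob_fps r)"
    using assms frob_fps_conv_radius[of r] by (metis ereal_less(3) less_le_trans)
  hence 2: "ereal (norm q) < fps_conv_radius (fps_deriv (frob_fps r))"
    using fps_conv_radius_deriv[of "frob_fps r"] by (rule less_le_trans)
  from 1 show "(eval_fps (frob_fps r) has_field_derivative eval_fps (fps_deriv (frob_fps r)) q) (at q)"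
    by (rule has_field_derivative_eval_fps)
  from 2 show "(eval_fps (fps_deriv (frob_fps r)) has_field_derivative
                  eval_fps (fps_deriv (fps_deriv (frob_fps r))) q) (at q)"
    by (rule has_field_derivative_eval_fps)
qed

text \<open>
  The differential equation for the power series factor, written with the operator \<open>q d/dq\<close>; the
  recursion is its comparison of coefficients, and the Cauchy product gives the right-hand side.
\<close>
lemma frob_fps_ODE:
  fixes q :: complex and r :: nat
  defines "F \<equiv> frob_fps r"
  assumes q: "norm q < 1"
  shows "q * (eval_fps (fps_deriv F) q + q * eval_fps (fps_deriv (fps_deriv F)) q) +
           of_nat r * (q * eval_fps (fps_deriv F) q) =
         60 * of_nat r ^ 2 * (\<Sum>n. of_nat (sigma3 n) * q ^ n) * eval_fps F q"
proof -
  note P = frob_fps_sums[OF q, of r, folded F_def]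
  have s1: "(\<lambda>n. of_nat n * of_real (frob_coeff r n) * z ^ n) sums (z * eval_fps (fps_deriv F) z)"
    if z: "norm z < 1" for z :: complex
  proof (rule sums_times_index[OF _ _ z])
    show "(\<lambda>n. of_real (frob_coeff r n) * w ^ n) sums eval_fps F w" if "norm w < 1" for w :: complex
      using frob_fps_sums[OF that] by (simp add: F_def)
    show "(eval_fps F has_field_derivative eval_fps (fps_deriv F) z) (at z)"
      unfolding F_def by (rule frob_fps_derivs[OF z])
  qed
  have s2: "(\<lambda>n. of_nat n * (of_nat n * of_real (frob_coeff r n)) * q ^ n) sums
               (q * (eval_fps (fps_deriv F) q + q * eval_fps (fps_deriv (fps_deriv F)) q))"
  proof (rule sums_times_index[OF s1 _ q])
    show "((\<lambda>z. z * eval_fps (fps_deriv F) z) has_field_derivative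
            eval_fps (fps_deriv F) q + q * eval_fps (fps_deriv (fps_deriv F)) q) (at q)"
      by (rule derivative_eq_intros refl frob_fps_derivs(2)[OF q, of r, folded F_def] | simp)+
  qed
  have "(\<lambda>n. of_nat n * (of_nat n * of_real (frob_coeff r n)) * q ^ n +
             of_nat r * (of_nat n * of_real (frob_coeff r n) * q ^ n)) sums
          (q * (eval_fps (fps_deriv F) q + q * eval_fps (fps_deriv (fps_deriv F)) q) +
             of_nat r * (q * eval_fps (fps_deriv F) q))"
    by (intro sums_add sums_mult s1 s2 q)
  also have "(\<lambda>n. of_nat n * (of_nat n * of_real (frob_coeff r n)) * q ^ n +
             of_nat r * (of_nat n * of_real (frob_coeff r n) * q ^ n)) =
             (\<lambda>n. 60 * of_nat r ^ 2 *
                (\<Sum>k\<le>n. (of_real (frob_coeff r k) * q ^ k) * (of_nat (sigma3 (n - k)) * q ^ (n - k))))"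
  proof
    fix n
    have "of_nat n * (of_nat n * of_real (frob_coeff r n)) * q ^ n +
             of_nat r * (of_nat n * of_real (frob_coeff r n) * q ^ n) =
          of_real (real n * real (n + r) * frob_coeff r n) * q ^ n"
      by (simp add: algebra_simps)
    also have "\<dots> = 60 * of_nat r ^ 2 *
                ((\<Sum>k\<le>n. of_nat (sigma3 (n - k)) * of_real (frob_coeff r k)) * q ^ n)"
      unfolding frob_coeff_rec by simp
    also have "(\<Sum>k\<le>n. of_nat (sigma3 (n - k)) * of_real (frob_coeff r k)) * q ^ n =
               (\<Sum>k\<le>n. (of_real (frob_coeff r k) * q ^ k) * (of_nat (sigma3 (n - k)) * q ^ (n - k)))"
      unfolding sum_distrib_right by (intro sum.cong refl) (auto simp: mult_ac simp flip: power_add)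
    finally show "of_nat n * (of_nat n * of_real (frob_coeff r n)) * q ^ n +
             of_nat r * (of_nat n * of_real (frob_coeff r n) * q ^ n) =
             60 * of_nat r ^ 2 *
                (\<Sum>k\<le>n. (of_real (frob_coeff r k) * q ^ k) * (of_nat (sigma3 (n - k)) * q ^ (n - k)))" .
  qed
  finally have lhs: "(\<lambda>n. 60 * of_nat r ^ 2 *
                (\<Sum>k\<le>n. (of_real (frob_coeff r k) * q ^ k) * (of_nat (sigma3 (n - k)) * q ^ (n - k)))) sums
          (q * (eval_fps (fps_deriv F) q + q * eval_fps (fps_deriv (fps_deriv F)) q) +
             of_nat r * (q * eval_fps (fps_deriv F) q))" .
  have "(\<lambda>n. \<Sum>k\<le>n. (of_real (frob_coeff r k) * q ^ k) * (of_nat (sigma3 (n - k)) * q ^ (n - k))) sums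
          ((\<Sum>n. of_real (frob_coeff r n) * q ^ n) * (\<Sum>n. of_nat (sigma3 n) * q ^ n))"
  proof (rule Cauchy_product_sums)
    show "summable (\<lambda>n. norm (of_real (frob_coeff r n) * q ^ n))"
      using summable_frob_coeff[of "norm q" r] q by (simp add: norm_mult norm_power frob_coeff_nonneg)
    have "summable (\<lambda>n. complex_of_real (real (sigma3 n) * norm q ^ n))"
      using summable_sigma3_power[of "of_real (norm q)"] q by simp
    thus "summable (\<lambda>n. norm (of_nat (sigma3 n) * q ^ n))"
      by (subst (asm) summable_of_real_iff) (simp add: norm_mult norm_power)
  qed
  hence "(\<lambda>n. 60 * of_nat r ^ 2 * (\<Sum>k\<le>n. (of_real (frob_coeff r k) * q ^ k) * (of_nat (sigma3 (n - k)) * q ^ (n - k)))) sums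
          (60 * of_nat r ^ 2 * ((\<Sum>n. of_real (frob_coeff r n) * q ^ n) * (\<Sum>n. of_nat (sigma3 n) * q ^ n)))"
    by (rule sums_mult)
  from sums_unique2[OF lhs this] P show ?thesis
    by (simp add: sums_iff mult_ac)
qed

text \<open>
  The derivative is carried along as a second function, which keeps Wronskians free of \<open>deriv\<close>.
\<close>
definition is_solution :: "complex \<Rightarrow> (complex \<Rightarrow> complex) \<Rightarrow> (complex \<Rightarrow> complex) \<Rightarrow> bool" where
  "is_solution c f f' \<longleftrightarrow> (\<forall>\<tau>\<in>upper_half_plane.
     (f has_field_derivative f' \<tau>) (at \<tau>) \<and> (f' has_field_derivative - c * E4 \<tau> * f \<tau>) (at \<tau>))"

lemma E4_sigma3_series:
  assumes "Im \<tau> > 0"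
  shows "E4 \<tau> = 1 + 240 * (\<Sum>n. of_nat (sigma3 n) * exp (2 * of_real pi * \<i> * \<tau>) ^ n)"
proof -
  define q where "q = exp (2 * of_real pi * \<i> * \<tau>)"
  have "norm q < 1"
    unfolding q_def by (rule norm_nome_less_1) fact
  hence "(\<Sum>n. of_nat (sigma3 (Suc n)) * q ^ Suc n) = (\<Sum>n. of_nat (sigma3 n) * q ^ n)"
    by (subst suminf_split_head[OF summable_sigma3_power]) auto
  thus ?thesis
    by (simp only: E4_def q_def)
qed

text \<open>
  The solution is \<open>y(\<tau>) = exp(\<pi>\<i>r\<tau>) F(q)\<close> with \<open>F\<close> the Frobenius power series. On the imaginary axis
  \<open>q\<close> is a positive real number, so nonnegativity of the coefficients makes \<open>y\<close> positive and
  nonincreasing in \<open>Im \<tau>\<close> there; only the values at two points exchanged by the inversion are recorded.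
\<close>
lemma frobenius_solution:
  obtains y y' A B where
    "is_solution (of_real pi ^ 2 * of_nat r ^ 2) y y'"
    "\<And>\<tau>. y (\<tau> + 1) = (- 1) ^ r * y \<tau>"
    "y (2 * \<i>) = of_real A" "y (\<i> / 2) = of_real B" "0 < A" "A \<le> B"
proof -
  define P where "P = eval_fps (frob_fps r)"
  define P1 where "P1 = eval_fps (fps_deriv (frob_fps r))"
  define P2 where "P2 = eval_fps (fps_deriv (fps_deriv (frob_fps r)))"
  note P = frob_fps_sums[of _ r, folded P_def] frob_fps_derivs[of _ r, folded P_def P1_def P2_def]
           frob_fps_ODE[of _ r, folded P_def P1_def P2_def]
  define p where "p = of_real pi * \<i>"
  have p2: "p ^ 2 = - (of_real pi ^ 2)" by (simp add: p_def power_mult_distrib)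
  define e where "e = (\<lambda>\<tau>. exp (p * of_nat r * \<tau>))"
  define q where "q = (\<lambda>\<tau>. exp (2 * p * \<tau>))"
  have q_eq: "q \<tau> = exp (2 * of_real pi * \<i> * \<tau>)" for \<tau>
    by (simp add: q_def p_def mult_ac)
  define y where "y = (\<lambda>\<tau>. e \<tau> * P (q \<tau>))"
  define y' where "y' = (\<lambda>\<tau>. p * e \<tau> * (of_nat r * P (q \<tau>) + 2 * (q \<tau> * P1 (q \<tau>))))"
  have de: "(e has_field_derivative p * of_nat r * e \<tau>) (at \<tau>)" for \<tau>
    unfolding e_def by (rule derivative_eq_intros refl | simp)+
  have dq: "(q has_field_derivative 2 * p * q \<tau>) (at \<tau>)" for \<tau>
    unfolding q_def by (rule derivative_eq_intros refl | simp)+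
  have sol: "is_solution (of_real pi ^ 2 * of_nat r ^ 2) y y'"
    unfolding is_solution_def
  proof (intro ballI conjI)
    fix \<tau> assume "\<tau> \<in> upper_half_plane"
    hence \<tau>: "Im \<tau> > 0" by (simp add: upper_half_plane_def)
    have q1: "norm (q \<tau>) < 1" using norm_nome_less_1[OF \<tau>] by (simp only: q_eq)
    have dP: "((\<lambda>\<tau>. P (q \<tau>)) has_field_derivative P1 (q \<tau>) * (2 * p * q \<tau>)) (at \<tau>)"
      by (rule DERIV_chain2[OF P(2)[OF q1] dq])
    have dP1: "((\<lambda>\<tau>. P1 (q \<tau>)) has_field_derivative P2 (q \<tau>) * (2 * p * q \<tau>)) (at \<tau>)"
      by (rule DERIV_chain2[OF P(3)[OF q1] dq])
    show "(y has_field_derivative y' \<tau>) (at \<tau>)"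
      unfolding y_def y'_def
      by (rule derivative_eq_intros refl de dP)+ (simp add: algebra_simps)
    define E where "E = (\<Sum>n. of_nat (sigma3 n) * q \<tau> ^ n)"
    have E4: "E4 \<tau> = 1 + 240 * E"
      unfolding E_def using E4_sigma3_series[OF \<tau>] by (simp only: q_eq)
    have ode: "q \<tau> * (P1 (q \<tau>) + q \<tau> * P2 (q \<tau>)) + of_nat r * (q \<tau> * P1 (q \<tau>)) =
                 60 * of_nat r ^ 2 * E * P (q \<tau>)"
      using P(4)[OF q1] by (simp add: E_def)
    have "(y' has_field_derivative
             p ^ 2 * e \<tau> * (of_nat r ^ 2 * P (q \<tau>) +
               4 * (q \<tau> * (P1 (q \<tau>) + q \<tau> * P2 (q \<tau>)) + of_nat r * (q \<tau> * P1 (q \<tau>))))) (at \<tau>)"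
      unfolding y'_def
      by (rule derivative_eq_intros refl de dP dP1 dq)+ (simp add: algebra_simps power2_eq_square)
    also have "p ^ 2 * e \<tau> * (of_nat r ^ 2 * P (q \<tau>) +
               4 * (q \<tau> * (P1 (q \<tau>) + q \<tau> * P2 (q \<tau>)) + of_nat r * (q \<tau> * P1 (q \<tau>)))) =
               - (of_real pi ^ 2 * of_nat r ^ 2) * E4 \<tau> * y \<tau>"
      unfolding ode p2 E4 y_def by (simp add: algebra_simps)
    finally show "(y' has_field_derivative - (of_real pi ^ 2 * of_nat r ^ 2) * E4 \<tau> * y \<tau>) (at \<tau>)" .
  qed
  have per: "y (\<tau> + 1) = (- 1) ^ r * y \<tau>" for \<tau>
  proof -
    have "e (\<tau> + 1) = e \<tau> * exp (of_nat r * p)"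
      by (simp add: e_def ring_distribs exp_add mult_ac)
    also have "exp (of_nat r * p) = (- 1) ^ r"
      unfolding exp_of_nat_mult by (simp add: p_def)
    finally have "e (\<tau> + 1) = (- 1) ^ r * e \<tau>" by simp
    moreover have "q (\<tau> + 1) = q \<tau>"
      using exp_two_pi_i by (simp add: q_eq ring_distribs exp_add)
    ultimately show ?thesis by (simp add: y_def)
  qed
  define g where "g = (\<lambda>t. exp (- pi * real r * t) * (\<Sum>n. frob_coeff r n * exp (- 2 * pi * t) ^ n))"
  have ser: "(\<lambda>n. frob_coeff r n * exp (- 2 * pi * t) ^ n) sums (\<Sum>n. frob_coeff r n * exp (- 2 * pi * t) ^ n)" 
    if "t > 0" for t
    using that by (intro summable_sums summable_frob_coeff) auto
  have yg: "y (\<i> * of_real t) = of_real (g t)" if "t > 0" for t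
  proof -
    have q: "q (\<i> * of_real t) = of_real (exp (- 2 * pi * t))"
      unfolding q_def p_def exp_of_real [symmetric] by (simp add: mult_ac)
    have "(\<lambda>n. of_real (frob_coeff r n) * q (\<i> * of_real t) ^ n) sums P (q (\<i> * of_real t))"
      using that by (intro P(1)) (simp add: q)
    moreover have "(\<lambda>n. of_real (frob_coeff r n) * q (\<i> * of_real t) ^ n) sums
                     of_real (\<Sum>n. frob_coeff r n * exp (- 2 * pi * t) ^ n)"
      using sums_of_real[OF ser[OF that], where ?'a = complex] by (simp add: q)
    ultimately have "P (q (\<i> * of_real t)) = of_real (\<Sum>n. frob_coeff r n * exp (- 2 * pi * t) ^ n)"
      by (rule sums_unique2)
    moreover have "e (\<i> * of_real t) = of_real (exp (- pi * real r * t))"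
      unfolding e_def p_def exp_of_real [symmetric] by (simp add: mult_ac)
    ultimately show ?thesis by (simp add: y_def g_def)
  qed
  have pos: "(\<Sum>n. frob_coeff r n * exp (- 2 * pi * t) ^ n) \<ge> 1" if "t > 0" for t
    using sum_le_suminf[of "\<lambda>n. frob_coeff r n * exp (- 2 * pi * t) ^ n" "{0}"] ser[OF that]
    by (auto simp: sums_iff frob_coeff_nonneg)
  have "g 2 > 0" using pos[of 2] by (simp add: g_def)
  moreover have "g 2 \<le> g (1 / 2)"
    unfolding g_def
  proof (intro mult_mono)
    show "(\<Sum>n. frob_coeff r n * exp (- 2 * pi * 2) ^ n) \<le> (\<Sum>n. frob_coeff r n * exp (- 2 * pi * (1 / 2)) ^ n)"
    proof (rule suminf_le)
      show "summable (\<lambda>n. frob_coeff r n * exp (- 2 * pi * 2) ^ n)" 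
        using ser[of 2] unfolding sums_iff by simp
      show "summable (\<lambda>n. frob_coeff r n * exp (- 2 * pi * (1 / 2)) ^ n)"
        using ser[of "1/2"] unfolding sums_iff by simp
      show "frob_coeff r n * exp (- 2 * pi * 2) ^ n \<le> frob_coeff r n * exp (- 2 * pi * (1 / 2)) ^ n" for n
        by (intro mult_left_mono power_mono frob_coeff_nonneg) auto
    qed
    show "exp (- pi * real r * 2) \<le> exp (- pi * real r * (1 / 2))"
      by (simp add: mult_left_mono)
    show "0 \<le> (\<Sum>n. frob_coeff r n * exp (- 2 * pi * 2) ^ n)" using pos[of 2] by simp
  qed auto
  moreover have "y (2 * \<i>) = of_real (g 2)" "y (\<i> / 2) = of_real (g (1 / 2))"
    using yg[of 2] yg[of "1/2"] by (simp_all add: mult.commute)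
  ultimately show thesis
    using that[OF sol per] by blast
qed

section \<open>Modular transformations of solutions and Wronskians\<close>

lemma open_upper_half_plane: "open upper_half_plane"
  unfolding upper_half_plane_def by (rule open_halfspace_Im_gt)

lemma convex_upper_half_plane: "convex upper_half_plane"
  unfolding upper_half_plane_def by (rule convex_halfspace_Im_gt)

lemma upper_half_plane_translate: "\<tau> \<in> upper_half_plane \<Longrightarrow> \<tau> + 1 \<in> upper_half_plane"
  by (simp add: upper_half_plane_def)

lemma upper_half_plane_invert: "\<tau> \<in> upper_half_plane \<Longrightarrow> - 1 / \<tau> \<in> upper_half_plane"
  by (simp add: upper_half_plane_def Im_divide power2_eq_square divide_pos_pos add_nonneg_pos)

lemma upper_half_plane_nonzero: "\<tau> \<in> upper_half_plane \<Longrightarrow> \<tau> \<noteq> 0"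
  by (auto simp: upper_half_plane_def)

lemma E4_translate: "E4 (\<tau> + 1) = E4 \<tau>"
  using exp_two_pi_i by (simp add: E4_def ring_distribs exp_add)

lemma is_solutionD:
  assumes "is_solution c f f'" "\<tau> \<in> upper_half_plane"
  shows "(f has_field_derivative f' \<tau>) (at \<tau>)"
        "(f' has_field_derivative - c * E4 \<tau> * f \<tau>) (at \<tau>)"
  using assms by (auto simp: is_solution_def)

lemma is_solution_holomorphic: "is_solution c f f' \<Longrightarrow> f holomorphic_on upper_half_plane"
  using open_upper_half_plane by (auto simp: is_solution_def holomorphic_on_open)

lemma is_solution_translate:
  assumes "is_solution c f f'"
  shows "is_solution c (\<lambda>\<tau>. f (\<tau> + 1)) (\<lambda>\<tau>. f' (\<tau> + 1))"
  unfolding is_solution_def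
proof (intro ballI conjI)
  fix \<tau> assume "\<tau> \<in> upper_half_plane"
  note D = is_solutionD[OF assms upper_half_plane_translate[OF this]]
  have s: "((\<lambda>\<tau>. \<tau> + 1) has_field_derivative 1) (at \<tau>)" for \<tau> :: complex
    by (rule derivative_eq_intros refl | simp)+
  show "((\<lambda>\<tau>. f (\<tau> + 1)) has_field_derivative f' (\<tau> + 1)) (at \<tau>)"
    using DERIV_chain2[OF D(1) s] by simp
  show "((\<lambda>\<tau>. f' (\<tau> + 1)) has_field_derivative - c * E4 \<tau> * f (\<tau> + 1)) (at \<tau>)"
    using DERIV_chain2[OF D(2) s] by (simp add: E4_translate)
qed

text \<open>
  The weights match: the potential \<open>E\<^sub>4\<close> has weight 4, so \<open>\<tau> f(-1/\<tau>)\<close>, the action of weight \<open>-1\<close>,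
  again solves the equation, since \<open>(\<tau> f(-1/\<tau>))'' = \<tau>\<^bsup>-3\<^esup> f''(-1/\<tau>)\<close>.
\<close>
lemma is_solution_invert:
  assumes "is_solution c f f'"
  shows "is_solution c (\<lambda>\<tau>. \<tau> * f (- 1 / \<tau>)) (\<lambda>\<tau>. f (- 1 / \<tau>) + f' (- 1 / \<tau>) / \<tau>)"
  unfolding is_solution_def
proof (intro ballI conjI)
  fix \<tau> assume \<tau>: "\<tau> \<in> upper_half_plane"
  note nz = upper_half_plane_nonzero[OF \<tau>]
  note D = is_solutionD[OF assms upper_half_plane_invert[OF \<tau>]]
  have s: "((\<lambda>\<tau>. - 1 / \<tau>) has_field_derivative 1 / \<tau> ^ 2) (at \<tau>)"
    using nz by (auto intro!: derivative_eq_intros simp: power2_eq_square)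
  have d1: "((\<lambda>\<tau>. f (- 1 / \<tau>)) has_field_derivative f' (- 1 / \<tau>) / \<tau> ^ 2) (at \<tau>)"
    using DERIV_chain2[OF D(1) s] by simp
  have d2: "((\<lambda>\<tau>. f' (- 1 / \<tau>)) has_field_derivative - c * E4 \<tau> * \<tau> ^ 2 * f (- 1 / \<tau>)) (at \<tau>)"
  proof -
    have "Im \<tau> > 0" using \<tau> by (simp add: upper_half_plane_def)
    hence "- c * E4 (- 1 / \<tau>) * f (- 1 / \<tau>) * (1 / \<tau> ^ 2) = - c * E4 \<tau> * \<tau> ^ 2 * f (- 1 / \<tau>)"
      using nz unfolding E4_minus_inverse[OF \<open>Im \<tau> > 0\<close>] by (simp add: eval_nat_numeral)
    thus ?thesis using DERIV_chain2[OF D(2) s] by simp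
  qed
  show "((\<lambda>\<tau>. \<tau> * f (- 1 / \<tau>)) has_field_derivative f (- 1 / \<tau>) + f' (- 1 / \<tau>) / \<tau>) (at \<tau>)"
    by (rule derivative_eq_intros refl d1)+ (use nz in \<open>simp add: power2_eq_square\<close>)
  show "((\<lambda>\<tau>. f (- 1 / \<tau>) + f' (- 1 / \<tau>) / \<tau>) has_field_derivative
           - c * E4 \<tau> * (\<tau> * f (- 1 / \<tau>))) (at \<tau>)"
    by (rule derivative_eq_intros refl d1 d2 nz)+ (use nz in \<open>simp add: power2_eq_square field_simps\<close>)
qed

lemma Wronskian_const:
  assumes "is_solution c f f'" "is_solution c g g'"
  obtains W where "\<And>\<tau>. \<tau> \<in> upper_half_plane \<Longrightarrow> f \<tau> * g' \<tau> - f' \<tau> * g \<tau> = W"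
proof -
  have "((\<lambda>\<tau>. f \<tau> * g' \<tau> - f' \<tau> * g \<tau>) has_field_derivative 0) (at \<tau> within upper_half_plane)"
    if "\<tau> \<in> upper_half_plane" for \<tau>
    by (rule has_field_derivative_at_within)
       ((rule derivative_eq_intros refl is_solutionD[OF assms(1) that] is_solutionD[OF assms(2) that])+,
        simp add: algebra_simps)
  from has_field_derivative_zero_constant[OF convex_upper_half_plane this] that show thesis by blast
qed

text \<open>
  Near a point where \<open>g\<close> does not vanish the quotient has derivative zero; the identity theorem
  extends the resulting relation to all of the half-plane, including the zeros of \<open>g\<close>.
\<close>
lemma Wronskian_zero_imp_proportional:
  assumes f: "is_solution c f f'" and g: "is_solution c g g'"
  assumes W: "\<And>\<tau>. \<tau> \<in> upper_half_plane \<Longrightarrow> f \<tau> * g' \<tau> - f' \<tau> * g \<tau> = 0"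
  assumes "\<tau>0 \<in> upper_half_plane" "g \<tau>0 \<noteq> 0"
  obtains k where "\<And>\<tau>. \<tau> \<in> upper_half_plane \<Longrightarrow> f \<tau> = k * g \<tau>"
proof -
  have "isCont g \<tau>0"
    using is_solutionD(1)[OF g assms(4)] by (rule DERIV_isCont)
  then obtain d1 where d1: "d1 > 0" "\<And>\<tau>. dist \<tau> \<tau>0 < d1 \<Longrightarrow> g \<tau> \<noteq> 0"
    using continuous_at_avoid[of \<tau>0 g 0] assms(5) by (auto simp: dist_commute)
  obtain d2 where d2: "d2 > 0" "ball \<tau>0 d2 \<subseteq> upper_half_plane"
    using open_upper_half_plane assms(4) open_contains_ball by blast
  define B where "B = ball \<tau>0 (min d1 d2)"
  have B: "\<tau> \<in> upper_half_plane" "g \<tau> \<noteq> 0" if "\<tau> \<in> B" for \<tau>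
    using that d1 d2 by (auto simp: B_def dist_commute)
  have "((\<lambda>\<tau>. f \<tau> / g \<tau>) has_field_derivative 0) (at \<tau> within B)" if "\<tau> \<in> B" for \<tau>
  proof (rule has_field_derivative_at_within)
    have "f' \<tau> * g \<tau> - f \<tau> * g' \<tau> = 0"
      using W[OF B(1)[OF that]] by (simp add: algebra_simps)
    thus "((\<lambda>\<tau>. f \<tau> / g \<tau>) has_field_derivative 0) (at \<tau>)"
      by (auto intro!: derivative_eq_intros is_solutionD(1)[OF f] is_solutionD(1)[OF g] B that)
  qed
  moreover have "convex B" by (simp add: B_def)
  ultimately obtain k where k: "\<And>\<tau>. \<tau> \<in> B \<Longrightarrow> f \<tau> / g \<tau> = k"
    using has_field_derivative_zero_constant[of B "\<lambda>\<tau>. f \<tau> / g \<tau>"] by blast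
  have "f \<tau> = k * g \<tau>" if "\<tau> \<in> upper_half_plane" for \<tau>
  proof (rule analytic_continuation_open[where s = B and s' = upper_half_plane and f = f and g = "\<lambda>\<tau>. k * g \<tau>"])
    show "open B" "B \<noteq> {}" using d1 d2 by (auto simp: B_def)
    show "f \<tau> = k * g \<tau>" if "\<tau> \<in> B" for \<tau>
      using k[OF that] B(2)[OF that] by (simp add: field_simps)
    show "f holomorphic_on upper_half_plane" "(\<lambda>\<tau>. k * g \<tau>) holomorphic_on upper_half_plane"
      using is_solution_holomorphic[OF f] is_solution_holomorphic[OF g] by (auto intro!: holomorphic_intros)
  qed (use that B in \<open>auto intro!: open_upper_half_plane convex_connected convex_upper_half_plane\<close>)
  thus thesis by (rule that)
qed

section \<open>The basis of solutions adapted to the modular group\<close>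

text \<open>
  The heart of the argument: a basis of solutions on which the generators \<open>\<tau> + 1\<close> and \<open>-1/\<tau>\<close> act,
  up to scalar factors, by their standard matrices.
\<close>
lemma equivariant_solution_pair:
  fixes r :: nat
  defines "c \<equiv> of_real pi ^ 2 * of_nat r ^ 2"
  obtains p p' y y' and W b :: complex where
    "is_solution c p p'" "is_solution c y y'"
    "\<And>\<tau>. \<tau> \<in> upper_half_plane \<Longrightarrow> p \<tau> * y' \<tau> - p' \<tau> * y \<tau> = W" "W \<noteq> 0" "b \<noteq> 0"
    "y (2 * \<i>) \<noteq> 0"
    "\<And>\<tau>. \<tau> \<in> upper_half_plane \<Longrightarrow> y (\<tau> + 1) = (- 1) ^ r * y \<tau>"
    "\<And>\<tau>. \<tau> \<in> upper_half_plane \<Longrightarrow> p (\<tau> + 1) = (- 1) ^ r * (p \<tau> + y \<tau>)"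
    "\<And>\<tau>. \<tau> \<in> upper_half_plane \<Longrightarrow> y (- 1 / \<tau>) = b / \<tau> * p \<tau>"
    "\<And>\<tau>. \<tau> \<in> upper_half_plane \<Longrightarrow> p (- 1 / \<tau>) = b / \<tau> * (- y \<tau>)"
proof -
  obtain y y' A B where y: "is_solution c y y'" and T_y: "\<And>\<tau>. y (\<tau> + 1) = (- 1) ^ r * y \<tau>"
    and AB: "y (2 * \<i>) = of_real A" "y (\<i> / 2) = of_real B" "0 < A" "A \<le> B"
    unfolding c_def using frobenius_solution[of r] by metis
  define \<epsilon> :: complex where "\<epsilon> = (- 1) ^ r"
  have \<epsilon>: "\<epsilon> * \<epsilon> = 1" "\<epsilon> \<noteq> 0" by (auto simp: \<epsilon>_def simp flip: power_mult_distrib)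
  define u where "u = (\<lambda>\<tau>. \<tau> * y (- 1 / \<tau>))"
  define u' where "u' = (\<lambda>\<tau>. y (- 1 / \<tau>) + y' (- 1 / \<tau>) / \<tau>)"
  have u: "is_solution c u u'"
    unfolding u_def u'_def by (rule is_solution_invert[OF y])
  have S_y: "y (- 1 / \<tau>) = u \<tau> / \<tau>" if "\<tau> \<in> upper_half_plane" for \<tau>
    using upper_half_plane_nonzero[OF that] by (simp add: u_def)
  have S_u: "u (- 1 / \<tau>) = - y \<tau> / \<tau>" if "\<tau> \<in> upper_half_plane" for \<tau>
    using upper_half_plane_nonzero[OF that] by (simp add: u_def)
  have i2: "2 * \<i> \<in> upper_half_plane" and i12: "\<i> / 2 \<in> upper_half_plane"
    by (auto simp: upper_half_plane_def)
  have y_i2: "y (2 * \<i>) \<noteq> 0" using AB by simp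
  obtain W where W: "\<And>\<tau>. \<tau> \<in> upper_half_plane \<Longrightarrow> u \<tau> * y' \<tau> - u' \<tau> * y \<tau> = W"
    using Wronskian_const[OF u y] by blast
  \<comment> \<open>If \<open>u = k y\<close>, then \<open>2\<i> B = k A\<close> and \<open>\<i>/2 A = k B\<close>, so \<open>4 B\<^sup>2 = A\<^sup>2\<close>, against \<open>0 < A \<le> B\<close>.\<close>
  have indep: False if "\<And>\<tau>. \<tau> \<in> upper_half_plane \<Longrightarrow> u \<tau> = k * y \<tau>" for k
  proof -
    have 1: "- 1 / (2 * \<i>) = \<i> / 2" and 2: "- 1 / (\<i> / 2) = 2 * \<i>"
      by (auto simp: field_simps)
    have "2 * \<i> * of_real B = k * of_real A"
      using that[OF i2] AB unfolding u_def 1 by simp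
    moreover have "\<i> / 2 * of_real A = k * of_real B"
      using that[OF i12] AB unfolding u_def 2 by simp
    ultimately have "2 * \<i> * of_real B * of_real B = \<i> / 2 * of_real A * of_real A"
      by (metis mult.assoc mult.commute)
    hence "complex_of_real (4 * B * B) = of_real (A * A)"
      by (simp add: field_simps)
    hence "4 * B * B = A * A" by (simp only: of_real_eq_iff)
    moreover have "A * A \<le> B * B" "B * B > 0" using AB by (auto intro: mult_mono)
    ultimately show False by simp
  qed
  have W0: "W \<noteq> 0"
  proof
    assume "W = 0"
    with Wronskian_zero_imp_proportional[OF u y _ i2 y_i2] W indep show False by blast
  qed
  \<comment> \<open>The Wronskian with \<open>y\<close> of \<open>u(\<tau> + 1)\<close> is \<open>\<epsilon>\<close> times that of \<open>u\<close>, because \<open>y(\<tau> + 1) = \<epsilon> y(\<tau>)\<close> and \<open>\<epsilon>\<^sup>2 = 1\<close>.\<close>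
  obtain \<beta> where \<beta>: "\<And>\<tau>. \<tau> \<in> upper_half_plane \<Longrightarrow> u (\<tau> + 1) - \<epsilon> * u \<tau> = \<beta> * y \<tau>"
  proof -
    have "is_solution c (\<lambda>\<tau>. u (\<tau> + 1) - \<epsilon> * u \<tau>) (\<lambda>\<tau>. u' (\<tau> + 1) - \<epsilon> * u' \<tau>)"
      using u is_solution_translate[OF u] unfolding is_solution_def
      by (auto intro!: derivative_eq_intros simp: algebra_simps)
    moreover have "(u (\<tau> + 1) - \<epsilon> * u \<tau>) * y' \<tau> - (u' (\<tau> + 1) - \<epsilon> * u' \<tau>) * y \<tau> = 0"
      if \<tau>: "\<tau> \<in> upper_half_plane" for \<tau>
    proof -
      have T_y': "y' (\<tau> + 1) = \<epsilon> * y' \<tau>"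
      proof (rule DERIV_unique)
        show "((\<lambda>\<tau>. y (\<tau> + 1)) has_field_derivative y' (\<tau> + 1)) (at \<tau>)"
          using is_solutionD(1)[OF is_solution_translate[OF y] \<tau>] .
        show "((\<lambda>\<tau>. y (\<tau> + 1)) has_field_derivative \<epsilon> * y' \<tau>) (at \<tau>)"
          unfolding T_y by (rule derivative_eq_intros refl is_solutionD(1)[OF y \<tau>])+ (simp add: \<epsilon>_def)
      qed
      have y_T: "y \<tau> = \<epsilon> * y (\<tau> + 1)" "y' \<tau> = \<epsilon> * y' (\<tau> + 1)"
        using T_y[of \<tau>] T_y' \<epsilon>(1) by (simp_all add: \<epsilon>_def flip: mult.assoc)
      have "u (\<tau> + 1) * y' \<tau> - u' (\<tau> + 1) * y \<tau> = \<epsilon> * W"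
        unfolding y_T W[OF upper_half_plane_translate[OF \<tau>], symmetric] by (simp add: algebra_simps)
      moreover have "\<epsilon> * W = \<epsilon> * u \<tau> * y' \<tau> - \<epsilon> * u' \<tau> * y \<tau>"
        unfolding W[OF \<tau>, symmetric] by (simp add: algebra_simps)
      ultimately show ?thesis by (simp add: algebra_simps)
    qed
    ultimately show thesis
      using Wronskian_zero_imp_proportional[OF _ y _ i2 y_i2] that by blast
  qed
  define b where "b = \<epsilon> * \<beta>"
  have T_u: "u (\<tau> + 1) = \<epsilon> * (u \<tau> + b * y \<tau>)" if "\<tau> \<in> upper_half_plane" for \<tau>
  proof -
    have "\<epsilon> * b = \<beta>" using \<epsilon>(1) by (simp add: b_def flip: mult.assoc)
    have "u (\<tau> + 1) = \<epsilon> * u \<tau> + \<beta> * y \<tau>"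
      using \<beta>[OF that] by (simp add: algebra_simps)
    also have "\<dots> = \<epsilon> * (u \<tau> + b * y \<tau>)"
      by (simp add: ring_distribs flip: \<open>\<epsilon> * b = \<beta>\<close>)
    finally show ?thesis .
  qed
  \<comment> \<open>The map \<open>\<tau> \<mapsto> -1/(\<tau> + 1)\<close> has order three and acts on \<open>(u, y)\<close> by \<open>M = (0, -1; 1, b)\<close> up to a scalar.
    By Cayley-Hamilton \<open>M\<^sup>3 = (b\<^sup>2 - 1) M - b\<close>, so \<open>b\<^sup>2 \<noteq> 1\<close> would make \<open>u\<close> and \<open>y\<close> linearly dependent.\<close>
  have b: "b * b = 1"
  proof (rule ccontr)
    assume bb: "b * b \<noteq> 1"
    have ST_u: "u (- 1 / (\<tau> + 1)) = - \<epsilon> / (\<tau> + 1) * y \<tau>"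
      and ST_y: "y (- 1 / (\<tau> + 1)) = \<epsilon> / (\<tau> + 1) * (u \<tau> + b * y \<tau>)" if \<tau>: "\<tau> \<in> upper_half_plane" for \<tau>
      using S_u[OF upper_half_plane_translate[OF \<tau>]] S_y[OF upper_half_plane_translate[OF \<tau>]] T_y[of \<tau>] T_u[OF \<tau>]
      by (simp_all add: \<epsilon>_def)
    have "y \<tau> = - \<epsilon> * ((b * b - 1) * (u \<tau> + b * y \<tau>) - b * y \<tau>)" if \<tau>: "\<tau> \<in> upper_half_plane" for \<tau>
    proof -
      define \<tau>1 where "\<tau>1 = - 1 / (\<tau> + 1)"
      define \<tau>2 where "\<tau>2 = - 1 / (\<tau>1 + 1)"
      note \<tau>1 = upper_half_plane_invert[OF upper_half_plane_translate[OF \<tau>], folded \<tau>1_def]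
      note \<tau>2 = upper_half_plane_invert[OF upper_half_plane_translate[OF \<tau>1], folded \<tau>2_def]
      note nz = upper_half_plane_nonzero[OF \<tau>] upper_half_plane_nonzero[OF upper_half_plane_translate[OF \<tau>]]
      have e1: "\<tau>1 + 1 = \<tau> / (\<tau> + 1)" using nz by (simp add: \<tau>1_def field_simps)
      have e2: "\<tau>2 + 1 = - 1 / \<tau>" unfolding \<tau>2_def e1 using nz by (simp add: field_simps)
      have e3: "- 1 / (\<tau>2 + 1) = \<tau>" using nz by (simp add: e2)
      have "y \<tau> = \<epsilon> / (\<tau>2 + 1) * (u \<tau>2 + b * y \<tau>2)"
        using ST_y[OF \<tau>2] unfolding e3 .
      also have "u \<tau>2 = - \<epsilon> / (\<tau>1 + 1) * y \<tau>1" unfolding \<tau>2_def by (rule ST_u[OF \<tau>1])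
      also have "y \<tau>2 = \<epsilon> / (\<tau>1 + 1) * (u \<tau>1 + b * y \<tau>1)" unfolding \<tau>2_def by (rule ST_y[OF \<tau>1])
      also have "u \<tau>1 = - \<epsilon> / (\<tau> + 1) * y \<tau>" unfolding \<tau>1_def by (rule ST_u[OF \<tau>])
      also have "y \<tau>1 = \<epsilon> / (\<tau> + 1) * (u \<tau> + b * y \<tau>)" unfolding \<tau>1_def by (rule ST_y[OF \<tau>])
      finally have *: "y \<tau> = \<epsilon> / (\<tau>2 + 1) * (- \<epsilon> / (\<tau>1 + 1) * (\<epsilon> / (\<tau> + 1) * (u \<tau> + b * y \<tau>)) +
          b * (\<epsilon> / (\<tau>1 + 1) * (- \<epsilon> / (\<tau> + 1) * y \<tau> + b * (\<epsilon> / (\<tau> + 1) * (u \<tau> + b * y \<tau>)))))" .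
      have id: "\<epsilon> / a2 * (- \<epsilon> / a1 * (\<epsilon> / a0 * v) + b * (\<epsilon> / a1 * (- \<epsilon> / a0 * w + b * (\<epsilon> / a0 * v)))) =
                 \<epsilon> * \<epsilon> * \<epsilon> / (a2 * a1 * a0) * ((b * b - 1) * v - b * w)" for a0 a1 a2 v w
        by (simp add: divide_inverse algebra_simps)
      from * have "y \<tau> = \<epsilon> * \<epsilon> * \<epsilon> / ((\<tau>2 + 1) * (\<tau>1 + 1) * (\<tau> + 1)) *
          ((b * b - 1) * (u \<tau> + b * y \<tau>) - b * y \<tau>)"
        unfolding id .
      also have "(\<tau>2 + 1) * (\<tau>1 + 1) * (\<tau> + 1) = - 1"
        unfolding e1 e2 using nz by simp
      finally show ?thesis by (simp add: \<epsilon>(1))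
    qed
    hence "\<epsilon> * (b * b - 1) * u \<tau> = (\<epsilon> * b - 1 - \<epsilon> * (b * b - 1) * b) * y \<tau>"
      if "\<tau> \<in> upper_half_plane" for \<tau>
      using that by (simp add: algebra_simps) 
    hence "u \<tau> = (\<epsilon> * b - 1 - \<epsilon> * (b * b - 1) * b) / (\<epsilon> * (b * b - 1)) * y \<tau>"
      if "\<tau> \<in> upper_half_plane" for \<tau>
      using that bb \<epsilon>(2) by (simp add: nonzero_eq_divide_eq mult_ac)
    thus False by (rule indep)
  qed
  hence b0: "b \<noteq> 0" by auto
  \<comment> \<open>Rescaling \<open>u\<close> by \<open>b = \<plusminus>1\<close> normalises the translation without disturbing the inversion.\<close>
  show thesis
  proof (rule that)
    show "is_solution c (\<lambda>\<tau>. b * u \<tau>) (\<lambda>\<tau>. b * u' \<tau>)"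
      using u unfolding is_solution_def by (auto intro!: derivative_eq_intros simp: algebra_simps)
    show "is_solution c y y'" by fact
    show "b * u \<tau> * y' \<tau> - b * u' \<tau> * y \<tau> = b * W" if "\<tau> \<in> upper_half_plane" for \<tau>
      unfolding W[OF that, symmetric] by (simp add: algebra_simps)
    show "b * W \<noteq> 0" "b \<noteq> 0" using b0 W0 by auto
    show "y (2 * \<i>) \<noteq> 0" by (rule y_i2)
    show "y (\<tau> + 1) = (- 1) ^ r * y \<tau>" for \<tau> by (rule T_y)
    show "b * u (\<tau> + 1) = (- 1) ^ r * (b * u \<tau> + y \<tau>)" if "\<tau> \<in> upper_half_plane" for \<tau>
    proof -
      have "b * u (\<tau> + 1) = \<epsilon> * (b * u \<tau> + (b * b) * y \<tau>)"
        unfolding T_u[OF that] by (simp only: ring_distribs mult_ac)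
      thus ?thesis by (simp add: b \<epsilon>_def)
    qed
    show "y (- 1 / \<tau>) = b / \<tau> * (b * u \<tau>)" if "\<tau> \<in> upper_half_plane" for \<tau>
      using S_y[OF that] b by (simp flip: mult.assoc)
    show "b * u (- 1 / \<tau>) = b / \<tau> * (- y \<tau>)" if "\<tau> \<in> upper_half_plane" for \<tau>
      using S_u[OF that] by simp
  qed
qed

section \<open>Equivariance from the generators of the modular group\<close>

text \<open>
  A projective form of equivariance that has no exceptional points: the vector \<open>(p, y)\<close> transforms by
  the matrix up to a nonzero factor. Demanding that the image stays in the half-plane makes all
  denominators nonzero, because a fraction with denominator 0 has the value 0, which lies outside; this
  makes the property closed under matrix products.
\<close>
definition proj_equivariant ::
    "(complex \<Rightarrow> complex) \<Rightarrow> (complex \<Rightarrow> complex) \<Rightarrow> int \<Rightarrow> int \<Rightarrow> int \<Rightarrow> int \<Rightarrow> bool" where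
  "proj_equivariant p y a b c d \<longleftrightarrow> (\<forall>\<tau>\<in>upper_half_plane.
     moebius (of_int a) (of_int b) (of_int c) (of_int d) \<tau> \<in> upper_half_plane \<and>
     (\<exists>l. l \<noteq> 0 \<and>
        p (moebius (of_int a) (of_int b) (of_int c) (of_int d) \<tau>) = l * (of_int a * p \<tau> + of_int b * y \<tau>) \<and>
        y (moebius (of_int a) (of_int b) (of_int c) (of_int d) \<tau>) = l * (of_int c * p \<tau> + of_int d * y \<tau>)))"

lemma proj_equivariant_compose:
  assumes M: "proj_equivariant p y a b c d" and M': "proj_equivariant p y a' b' c' d'"
  assumes "a'' = a * a' + b * c'" "b'' = a * b' + b * d'" "c'' = c * a' + d * c'" "d'' = c * b' + d * d'"
  shows "proj_equivariant p y a'' b'' c'' d''"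
  unfolding proj_equivariant_def
proof
  fix \<tau> assume \<tau>: "\<tau> \<in> upper_half_plane"
  define \<tau>' where "\<tau>' = moebius (of_int a') (of_int b') (of_int c') (of_int d') \<tau>"
  define \<tau>'' where "\<tau>'' = moebius (of_int a) (of_int b) (of_int c) (of_int d) \<tau>'"
  obtain l' where \<tau>': "\<tau>' \<in> upper_half_plane" and l': "l' \<noteq> 0"
    "p \<tau>' = l' * (of_int a' * p \<tau> + of_int b' * y \<tau>)" "y \<tau>' = l' * (of_int c' * p \<tau> + of_int d' * y \<tau>)"
    using M' \<tau> unfolding proj_equivariant_def \<tau>'_def by blast
  obtain l where \<tau>'': "\<tau>'' \<in> upper_half_plane" and l: "l \<noteq> 0"
    "p \<tau>'' = l * (of_int a * p \<tau>' + of_int b * y \<tau>')" "y \<tau>'' = l * (of_int c * p \<tau>' + of_int d * y \<tau>')"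
    using M \<tau>' unfolding proj_equivariant_def \<tau>''_def by blast
  have nz: "of_int c' * \<tau> + of_int d' \<noteq> 0"
    using upper_half_plane_nonzero[OF \<tau>'] by (auto simp: \<tau>'_def moebius_def)
  have nz': "of_int c * \<tau>' + of_int d \<noteq> 0"
    using upper_half_plane_nonzero[OF \<tau>''] by (auto simp: \<tau>''_def moebius_def)
  have comp: "moebius (of_int a'') (of_int b'') (of_int c'') (of_int d'') \<tau> = \<tau>''"
  proof -
    define m where "m = of_int c' * \<tau> + of_int d'"
    define n where "n = of_int a' * \<tau> + of_int b'"
    have m: "m \<noteq> 0" using nz by (simp add: m_def)
    have \<tau>': "\<tau>' = n / m" by (simp add: \<tau>'_def moebius_def m_def n_def)
    have "\<tau>'' = (of_int a * n + of_int b * m) / m / ((of_int c * n + of_int d * m) / m)"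
      using m by (simp add: \<tau>''_def moebius_def \<tau>' add_divide_distrib)
    also have "\<dots> = (of_int a * n + of_int b * m) / (of_int c * n + of_int d * m)"
      using m by simp
    also have "\<dots> = moebius (of_int a'') (of_int b'') (of_int c'') (of_int d'') \<tau>"
      by (simp add: moebius_def assms m_def n_def algebra_simps)
    finally show ?thesis ..
  qed
  show "moebius (of_int a'') (of_int b'') (of_int c'') (of_int d'') \<tau> \<in> upper_half_plane \<and>
     (\<exists>l. l \<noteq> 0 \<and>
        p (moebius (of_int a'') (of_int b'') (of_int c'') (of_int d'') \<tau>) = l * (of_int a'' * p \<tau> + of_int b'' * y \<tau>) \<and>
        y (moebius (of_int a'') (of_int b'') (of_int c'') (of_int d'') \<tau>) = l * (of_int c'' * p \<tau> + of_int d'' * y \<tau>))"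
    unfolding comp
  proof (intro conjI exI)
    show "\<tau>'' \<in> upper_half_plane" by fact
    show "l * l' \<noteq> 0" using l l' by simp
  qed (simp_all add: l l' assms algebra_simps)
qed

lemma proj_equivariant_uminus:
  assumes "proj_equivariant p y a b c d"
  shows   "proj_equivariant p y (- a) (- b) (- c) (- d)"
proof -
  have "moebius (of_int (- a)) (of_int (- b)) (of_int (- c)) (of_int (- d)) \<tau> =
        moebius (of_int a) (of_int b) (of_int c) (of_int d) \<tau>" for \<tau> :: complex
  proof -
    have "(- of_int a * \<tau> + - of_int b) / (- of_int c * \<tau> + - of_int d) =
          (- (of_int a * \<tau> + of_int b)) / (- (of_int c * \<tau> + of_int d))" by simp
    also have "\<dots> = (of_int a * \<tau> + of_int b) / (of_int c * \<tau> + of_int d)"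
      by (rule minus_divide_divide)
    finally show ?thesis by (simp add: moebius_def)
  qed
  note eq = this
  show ?thesis
    unfolding proj_equivariant_def eq
  proof
    fix \<tau> assume "\<tau> \<in> upper_half_plane"
    define \<tau>' where "\<tau>' = moebius (of_int a) (of_int b) (of_int c) (of_int d) \<tau>"
    obtain l where l: "\<tau>' \<in> upper_half_plane" "l \<noteq> 0"
      "p \<tau>' = l * (of_int a * p \<tau> + of_int b * y \<tau>)" "y \<tau>' = l * (of_int c * p \<tau> + of_int d * y \<tau>)"
      using assms \<open>\<tau> \<in> upper_half_plane\<close> unfolding proj_equivariant_def \<tau>'_def by blast
    show "\<tau>' \<in> upper_half_plane \<and> (\<exists>l. l \<noteq> 0 \<and>
            p \<tau>' = l * (of_int (- a) * p \<tau> + of_int (- b) * y \<tau>) \<and>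
            y \<tau>' = l * (of_int (- c) * p \<tau> + of_int (- d) * y \<tau>))"
      using l by (intro conjI exI[of _ "- l"]) (auto simp: algebra_simps)
  qed
qed

lemma proj_equivariant_translations:
  assumes T: "proj_equivariant p y 1 1 0 1" and T': "proj_equivariant p y 1 (- 1) 0 1"
  shows   "proj_equivariant p y 1 k 0 1"
proof (induction k rule: int_induct[of _ 0])
  case base
  show ?case by (rule proj_equivariant_compose[OF T T']) auto
next
  case (step1 k)
  show ?case by (rule proj_equivariant_compose[OF step1(2) T]) auto
next
  case (step2 k)
  show ?case by (rule proj_equivariant_compose[OF step2(2) T']) auto
qed

text \<open>
  Euclid's algorithm on the bottom row. For \<open>c \<noteq> 0\<close> and \<open>k = d div c\<close>, the matrix factors as
  \<open>(b - ka, -a; d - kc, -c)\<close> times \<open>(0, 1; -1, -k)\<close>, where the first factor has the smaller lower left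
  entry \<open>d mod c\<close> and the second is minus the inversion times a translation.
\<close>
lemma proj_equivariant_SL2Z:
  assumes S: "proj_equivariant p y 0 (- 1) 1 0"
  assumes T: "proj_equivariant p y 1 1 0 1" and T': "proj_equivariant p y 1 (- 1) 0 1"
  assumes "a * d - b * c = 1"
  shows   "proj_equivariant p y a b c d"
  using assms(4)
proof (induction "nat \<bar>c\<bar>" arbitrary: a b c d rule: less_induct)
  case less
  note Tk = proj_equivariant_translations[OF T T']
  show ?case
  proof (cases "c = 0")
    case True
    hence "a * d = 1" using less.prems by simp
    hence "a = 1 \<and> d = 1 \<or> a = - 1 \<and> d = - 1" by (simp add: zmult_eq_1_iff)
    thus ?thesis
      using Tk[of b] proj_equivariant_uminus[OF Tk[of "- b"]] True by auto
  next
    case False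
    define k where "k = d div c"
    have dk: "d - k * c = d mod c" by (simp add: k_def minus_div_mult_eq_mod)
    have "proj_equivariant p y (b - k * a) (- a) (d - k * c) (- c)"
    proof (rule less.hyps)
      show "nat \<bar>d - k * c\<bar> < nat \<bar>c\<bar>"
        unfolding dk using False abs_mod_less[of c d] by simp
      show "(b - k * a) * (- c) - (- a) * (d - k * c) = 1"
        using less.prems by (simp add: algebra_simps)
    qed
    moreover have "proj_equivariant p y 0 1 (- 1) (- k)"
      by (rule proj_equivariant_compose[OF proj_equivariant_uminus[OF S] Tk[of k]]) auto
    ultimately show ?thesis
      by (rule proj_equivariant_compose) (auto simp: algebra_simps)
  qed
qed

section \<open>The quotient of two solutions\<close>

text \<open>
  Needed to fill in the value of the Schwarz derivative at the poles of the quotient.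
\<close>
lemma isCont_E4:
  assumes "\<tau> \<in> upper_half_plane"
  shows "isCont E4 \<tau>"
proof -
  define q where "q = (\<lambda>\<tau>. exp (2 * of_real pi * \<i> * \<tau>))"
  define S where "S = (\<lambda>q::complex. \<Sum>n. of_nat (sigma3 n) * q ^ n)"
  have "Im \<tau> > 0" using assms by (simp add: upper_half_plane_def)
  hence q1: "norm (q \<tau>) < 1" unfolding q_def by (rule norm_nome_less_1)
  then obtain x where x: "norm (q \<tau>) < x" "x < 1" using dense by blast
  have "0 < x" using x(1) norm_ge_zero by (rule le_less_trans[rotated])
  hence nx: "norm (complex_of_real x) = x" by simp
  have "isCont S (q \<tau>)"
    unfolding S_def
    by (rule isCont_powser[where K = "of_real x"], rule summable_sigma3_power) (simp_all only: nx x)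
  moreover have "isCont q \<tau>" unfolding q_def by (intro continuous_intros)
  ultimately have "isCont (\<lambda>\<tau>. 1 + 240 * S (q \<tau>)) \<tau>"
    by (intro continuous_intros isCont_o2[of \<tau> q S])
  moreover have "\<forall>\<^sub>F z in nhds \<tau>. z \<in> upper_half_plane"
    using open_upper_half_plane assms by (rule eventually_nhds_in_open)
  hence "\<forall>\<^sub>F z in nhds \<tau>. 1 + 240 * S (q z) = E4 z"
    by eventually_elim (use E4_sigma3_series in \<open>simp add: S_def q_def upper_half_plane_def\<close>)
  ultimately show ?thesis
    by (rule isCont_cong[THEN iffD1, rotated])
qed

text \<open>
  Away from the zeros of \<open>y\<close> one has \<open>h' = -W/y\<^sup>2\<close>, so \<open>h''/h' = -2y'/y\<close> and the Schwarz derivative is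
  \<open>-2y''/y\<close>. The zeros of \<open>y\<close> are isolated, and there the value follows by continuity of \<open>E\<^sub>4\<close>.
\<close>
lemma schwarzian_ratio:
  assumes p: "is_solution c p p'" and y: "is_solution c y y'"
  assumes W: "\<And>\<tau>. \<tau> \<in> upper_half_plane \<Longrightarrow> p \<tau> * y' \<tau> - p' \<tau> * y \<tau> = W" and W0: "W \<noteq> 0"
  assumes y0: "\<tau>0 \<in> upper_half_plane" "y \<tau>0 \<noteq> 0"
  defines "h \<equiv> (\<lambda>\<tau>. p \<tau> / y \<tau>)"
  shows "deriv h \<tau>0 \<noteq> 0"
    and "\<And>\<tau>. \<tau> \<in> upper_half_plane \<Longrightarrow> schwarzian h \<tau> = 2 * c * E4 \<tau>"
proof -
  define U where "U = upper_half_plane \<inter> y -` (- {0})"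
  have U: "\<tau> \<in> U \<longleftrightarrow> \<tau> \<in> upper_half_plane \<and> y \<tau> \<noteq> 0" for \<tau>
    by (auto simp: U_def)
  have "open U"
    unfolding U_def using is_solution_holomorphic[OF y, THEN holomorphic_on_imp_continuous_on]
    by (rule continuous_open_preimage) (auto intro: open_upper_half_plane)
  have dI: "deriv f \<tau> = D" if "(g has_field_derivative D) (at \<tau>)" "\<tau> \<in> U" "\<And>z. z \<in> U \<Longrightarrow> f z = g z"
    for f g :: "complex \<Rightarrow> complex" and D \<tau>
    by (rule DERIV_imp_deriv, rule has_field_derivative_transform_within_open[OF that(1) \<open>open U\<close> that(2)])
       (simp add: that(3))
  have dp: "(p has_field_derivative p' \<tau>) (at \<tau>)" and dy: "(y has_field_derivative y' \<tau>) (at \<tau>)"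
    and dy': "(y' has_field_derivative - c * E4 \<tau> * y \<tau>) (at \<tau>)" if "\<tau> \<in> U" for \<tau>
    using is_solutionD[OF p, of \<tau>] is_solutionD[OF y, of \<tau>] that by (auto simp: U)
  have h1: "deriv h \<tau> = - W / y \<tau> ^ 2" if \<tau>: "\<tau> \<in> U" for \<tau>
  proof (rule dI[OF _ \<tau>])
    have "((\<lambda>\<tau>. p \<tau> / y \<tau>) has_field_derivative (p' \<tau> * y \<tau> - p \<tau> * y' \<tau>) / (y \<tau> * y \<tau>)) (at \<tau>)"
      using \<tau> by (intro DERIV_divide dp dy) (auto simp: U)
    also have "p' \<tau> * y \<tau> - p \<tau> * y' \<tau> = - W"
      using W[of \<tau>] \<tau> by (simp add: U algebra_simps)
    finally show "((\<lambda>\<tau>. p \<tau> / y \<tau>) has_field_derivative - W / y \<tau> ^ 2) (at \<tau>)"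
      by (simp add: power2_eq_square)
  qed (simp add: h_def)
  have h2: "deriv (deriv h) \<tau> = 2 * W * y' \<tau> / y \<tau> ^ 3" if \<tau>: "\<tau> \<in> U" for \<tau>
  proof (rule dI[OF _ \<tau> h1])
    show "((\<lambda>\<tau>. - W / y \<tau> ^ 2) has_field_derivative 2 * W * y' \<tau> / y \<tau> ^ 3) (at \<tau>)"
      by (rule derivative_eq_intros refl dy[OF \<tau>])+
         (use \<tau> in \<open>simp_all add: U field_simps eval_nat_numeral\<close>)
  qed
  have h3: "deriv (\<lambda>z. deriv (deriv h) z / deriv h z) \<tau> = 2 * c * E4 \<tau> + 2 * (y' \<tau> / y \<tau>) ^ 2"
    if \<tau>: "\<tau> \<in> U" for \<tau>
  proof (rule dI[OF _ \<tau>])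
    show "((\<lambda>\<tau>. - 2 * (y' \<tau> / y \<tau>)) has_field_derivative 2 * c * E4 \<tau> + 2 * (y' \<tau> / y \<tau>) ^ 2) (at \<tau>)"
    proof -
      have "((\<lambda>\<tau>. - 2 * (y' \<tau> / y \<tau>)) has_field_derivative
              - 2 * ((- c * E4 \<tau> * y \<tau> * y \<tau> - y' \<tau> * y' \<tau>) / (y \<tau> * y \<tau>))) (at \<tau>)"
        using \<tau> by (intro DERIV_cmult DERIV_divide dy dy') (auto simp: U)
      also have "- 2 * ((- c * E4 \<tau> * y \<tau> * y \<tau> - y' \<tau> * y' \<tau>) / (y \<tau> * y \<tau>)) =
                 2 * c * E4 \<tau> + 2 * (y' \<tau> / y \<tau>) ^ 2"
        using \<tau> by (simp add: U field_simps power2_eq_square)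
      finally show ?thesis .
    qed
    show "deriv (deriv h) z / deriv h z = - 2 * (y' z / y z)" if "z \<in> U" for z
      using that W0 by (simp add: h1 h2 U field_simps eval_nat_numeral)
  qed
  show "deriv h \<tau>0 \<noteq> 0"
    using h1[of \<tau>0] y0 W0 by (simp add: U)
  show "schwarzian h \<tau> = 2 * c * E4 \<tau>" if \<tau>: "\<tau> \<in> upper_half_plane" for \<tau>
    unfolding schwarzian_def
  proof (rule remove_sings_eqI)
    have "isCont (\<lambda>\<tau>. 2 * c * E4 \<tau>) \<tau>"
      by (intro continuous_intros isCont_E4 \<tau>)
    hence "(\<lambda>\<tau>. 2 * c * E4 \<tau>) \<midarrow>\<tau>\<rightarrow> 2 * c * E4 \<tau>" by (simp add: isCont_def)
    moreover have "\<forall>\<^sub>F z in at \<tau>. z \<in> U"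
      using non_zero_neighbour_alt[OF is_solution_holomorphic[OF y] open_upper_half_plane
              convex_connected[OF convex_upper_half_plane] \<tau> y0]
      by (simp add: U conj_commute)
    hence "\<forall>\<^sub>F z in at \<tau>. 2 * c * E4 z = deriv (\<lambda>z. deriv (deriv h) z / deriv h z) z
             - 1 / 2 * (deriv (deriv h) z / deriv h z) ^ 2"
    proof eventually_elim
      case (elim z)
      have "deriv (deriv h) z / deriv h z = - 2 * (y' z / y z)"
        using elim W0 by (simp add: h1 h2 U field_simps eval_nat_numeral)
      thus ?case using h3[OF elim] by (simp add: power_mult_distrib power_divide)
    qed
    ultimately show "(\<lambda>\<tau>. deriv (\<lambda>z. deriv (deriv h) z / deriv h z) \<tau>
             - 1 / 2 * (deriv (deriv h) \<tau> / deriv h \<tau>) ^ 2) \<midarrow>\<tau>\<rightarrow> 2 * c * E4 \<tau>"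
      by (rule Lim_transform_eventually)
  qed
qed

text \<open>
  Since the Wronskian does not vanish, \<open>p\<close> and \<open>y\<close> have no common zero, so every zero of \<open>y\<close> is a pole
  of the quotient; the quotient takes the value \<open>p/0 = 0\<close> there, as nice meromorphicity requires.
\<close>
lemma ratio_poles:
  assumes p: "is_solution c p p'" and y: "is_solution c y y'"
  assumes W: "\<And>\<tau>. \<tau> \<in> upper_half_plane \<Longrightarrow> p \<tau> * y' \<tau> - p' \<tau> * y \<tau> = W" and W0: "W \<noteq> 0"
  assumes y0: "\<tau>0 \<in> upper_half_plane" "y \<tau>0 \<noteq> 0"
  shows "\<tau> \<in> upper_half_plane \<Longrightarrow> is_pole (\<lambda>\<tau>. p \<tau> / y \<tau>) \<tau> \<longleftrightarrow> y \<tau> = 0"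
    and "(\<lambda>\<tau>. p \<tau> / y \<tau>) nicely_meromorphic_on upper_half_plane"
proof -
  define h where "h = (\<lambda>\<tau>. p \<tau> / y \<tau>)"
  have cont: "isCont p \<tau>" "isCont y \<tau>" if "\<tau> \<in> upper_half_plane" for \<tau>
    using is_solutionD(1)[OF p that] is_solutionD(1)[OF y that] by (auto intro: DERIV_isCont)
  have pole: "is_pole h \<tau>" if \<tau>: "\<tau> \<in> upper_half_plane" "y \<tau> = 0" for \<tau>
    unfolding h_def
  proof (rule is_pole_divide)
    show "isCont p \<tau>" using cont \<tau> by blast
    show "p \<tau> \<noteq> 0" using W[OF \<tau>(1)] W0 \<tau>(2) by auto
    have "\<forall>\<^sub>F z in at \<tau>. y z \<noteq> 0 \<and> z \<in> upper_half_plane"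
      using non_zero_neighbour_alt[OF is_solution_holomorphic[OF y] open_upper_half_plane
              convex_connected[OF convex_upper_half_plane] \<tau>(1) y0] .
    moreover have "y \<midarrow>\<tau>\<rightarrow> 0" using cont(2)[OF \<tau>(1)] \<tau>(2) by (simp add: isCont_def)
    ultimately show "filterlim y (at 0) (at \<tau>)"
      by (auto simp: filterlim_at elim: eventually_mono)
  qed
  have lim: "h \<midarrow>\<tau>\<rightarrow> h \<tau>" if \<tau>: "\<tau> \<in> upper_half_plane" "y \<tau> \<noteq> 0" for \<tau>
    using cont[OF \<tau>(1)] \<tau>(2) unfolding h_def isCont_def by (intro tendsto_divide) auto
  show "is_pole (\<lambda>\<tau>. p \<tau> / y \<tau>) \<tau> \<longleftrightarrow> y \<tau> = 0" if \<tau>: "\<tau> \<in> upper_half_plane"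
  proof (cases "y \<tau> = 0")
    case False
    hence "\<not> is_pole h \<tau>"
      using lim[OF \<tau> False] not_tendsto_and_filterlim_at_infinity[of "at \<tau>" h "h \<tau>"]
      by (auto simp: is_pole_def)
    with False show ?thesis by (simp add: h_def)
  qed (use pole \<tau> in \<open>auto simp: h_def\<close>)
  have "p analytic_on upper_half_plane" "y analytic_on upper_half_plane"
    using is_solution_holomorphic[OF p] is_solution_holomorphic[OF y] open_upper_half_plane
    by (auto simp: analytic_on_open)
  hence "h meromorphic_on upper_half_plane"
    unfolding h_def by (intro meromorphic_on_divide analytic_on_imp_meromorphic_on)
  thus "(\<lambda>\<tau>. p \<tau> / y \<tau>) nicely_meromorphic_on upper_half_plane"
    using pole lim unfolding nicely_meromorphic_on_def h_def by (metis div_by_0)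
qed

section \<open>The equivariant solution\<close>

theorem proposition4p1:
  fixes r :: nat
  assumes "r > 0"
  shows "\<exists>h :: complex \<Rightarrow> complex.
           h nicely_meromorphic_on upper_half_plane
         \<and> \<not> h constant_on upper_half_plane
         \<and> (\<forall>\<tau>\<in>upper_half_plane.
              schwarzian h \<tau> = 2 * of_real pi ^ 2 * of_nat r ^ 2 * E4 \<tau>)
         \<and> (\<forall>\<gamma>\<in>SL2Z. \<forall>\<tau>\<in>upper_half_plane.
              sphere_val h (act \<gamma> \<tau>) = sphere_act \<gamma> (sphere_val h \<tau>))"
proof -
  obtain p p' y y' and W b :: complex where
    p: "is_solution (of_real pi ^ 2 * of_nat r ^ 2) p p'" and
    y: "is_solution (of_real pi ^ 2 * of_nat r ^ 2) y y'" and
    W: "\<And>\<tau>. \<tau> \<in> upper_half_plane \<Longrightarrow> p \<tau> * y' \<tau> - p' \<tau> * y \<tau> = W" and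
    W0: "W \<noteq> 0" and b: "b \<noteq> 0" and y0: "y (2 * \<i>) \<noteq> 0" and
    T_y: "\<And>\<tau>. \<tau> \<in> upper_half_plane \<Longrightarrow> y (\<tau> + 1) = (- 1) ^ r * y \<tau>" and
    T_p: "\<And>\<tau>. \<tau> \<in> upper_half_plane \<Longrightarrow> p (\<tau> + 1) = (- 1) ^ r * (p \<tau> + y \<tau>)" and
    S_y: "\<And>\<tau>. \<tau> \<in> upper_half_plane \<Longrightarrow> y (- 1 / \<tau>) = b / \<tau> * p \<tau>" and
    S_p: "\<And>\<tau>. \<tau> \<in> upper_half_plane \<Longrightarrow> p (- 1 / \<tau>) = b / \<tau> * (- y \<tau>)"
    by (rule equivariant_solution_pair[of r]) (rule that)
  define h where "h = (\<lambda>\<tau>. p \<tau> / y \<tau>)"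
  have i2: "2 * \<i> \<in> upper_half_plane" by (simp add: upper_half_plane_def)
  have sol: "schwarzian h \<tau> = 2 * of_real pi ^ 2 * of_nat r ^ 2 * E4 \<tau>"
    if "\<tau> \<in> upper_half_plane" for \<tau>
    using schwarzian_ratio(2)[OF p y W W0 i2 y0 that] by (simp add: h_def mult_ac)
  have nonconst: "\<not> h constant_on upper_half_plane"
  proof
    assume "h constant_on upper_half_plane"
    then obtain k where "\<And>\<tau>. \<tau> \<in> upper_half_plane \<Longrightarrow> h \<tau> = k"
      unfolding constant_on_def by blast
    hence "(h has_field_derivative 0) (at (2 * \<i>))"
      by (intro has_field_derivative_transform_within_open[OF DERIV_const open_upper_half_plane i2, of k]) simp
    hence "deriv h (2 * \<i>) = 0" by (rule DERIV_imp_deriv)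
    with schwarzian_ratio(1)[OF p y W W0 i2 y0] show False by (simp add: h_def)
  qed
  have T: "proj_equivariant p y 1 1 0 1"
    unfolding proj_equivariant_def
  proof
    fix \<tau> assume \<tau>: "\<tau> \<in> upper_half_plane"
    show "moebius (of_int 1) (of_int 1) (of_int 0) (of_int 1) \<tau> \<in> upper_half_plane \<and>
      (\<exists>l. l \<noteq> 0 \<and>
        p (moebius (of_int 1) (of_int 1) (of_int 0) (of_int 1) \<tau>) = l * (of_int 1 * p \<tau> + of_int 1 * y \<tau>) \<and>
        y (moebius (of_int 1) (of_int 1) (of_int 0) (of_int 1) \<tau>) = l * (of_int 0 * p \<tau> + of_int 1 * y \<tau>))"
      using upper_half_plane_translate[OF \<tau>] T_y[OF \<tau>] T_p[OF \<tau>]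
      by (intro conjI exI[of _ "(- 1) ^ r"]) (simp_all add: moebius_def)
  qed
  have T': "proj_equivariant p y 1 (- 1) 0 1"
    unfolding proj_equivariant_def
  proof
    fix \<tau> assume "\<tau> \<in> upper_half_plane"
    hence \<tau>: "\<tau> - 1 \<in> upper_half_plane" by (simp add: upper_half_plane_def)
    have e: "(- 1) ^ r * ((- 1) ^ r * x) = (x :: complex)" for x
      by (simp flip: mult.assoc power_mult_distrib)
    have "y (\<tau> - 1) = (- 1) ^ r * y \<tau>"
      using T_y[OF \<tau>] by (simp add: e)
    moreover have "p (\<tau> - 1) + y (\<tau> - 1) = (- 1) ^ r * p \<tau>"
      using T_p[OF \<tau>] by (simp add: e)
    ultimately show "moebius (of_int 1) (of_int (- 1)) (of_int 0) (of_int 1) \<tau> \<in> upper_half_plane \<and>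
      (\<exists>l. l \<noteq> 0 \<and>
        p (moebius (of_int 1) (of_int (- 1)) (of_int 0) (of_int 1) \<tau>) = l * (of_int 1 * p \<tau> + of_int (- 1) * y \<tau>) \<and>
        y (moebius (of_int 1) (of_int (- 1)) (of_int 0) (of_int 1) \<tau>) = l * (of_int 0 * p \<tau> + of_int 1 * y \<tau>))"
      using \<tau> by (intro conjI exI[of _ "(- 1) ^ r"]) (simp_all add: moebius_def algebra_simps)
  qed
  have S: "proj_equivariant p y 0 (- 1) 1 0"
    unfolding proj_equivariant_def
  proof
    fix \<tau> assume \<tau>: "\<tau> \<in> upper_half_plane"
    show "moebius (of_int 0) (of_int (- 1)) (of_int 1) (of_int 0) \<tau> \<in> upper_half_plane \<and>
      (\<exists>l. l \<noteq> 0 \<and>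
        p (moebius (of_int 0) (of_int (- 1)) (of_int 1) (of_int 0) \<tau>) = l * (of_int 0 * p \<tau> + of_int (- 1) * y \<tau>) \<and>
        y (moebius (of_int 0) (of_int (- 1)) (of_int 1) (of_int 0) \<tau>) = l * (of_int 1 * p \<tau> + of_int 0 * y \<tau>))"
      using upper_half_plane_invert[OF \<tau>] S_y[OF \<tau>] S_p[OF \<tau>] b upper_half_plane_nonzero[OF \<tau>]
      by (intro conjI exI[of _ "b / \<tau>"]) (simp_all add: moebius_def)
  qed
  have equi: "sphere_val h (act \<gamma> \<tau>) = sphere_act \<gamma> (sphere_val h \<tau>)"
    if \<gamma>: "\<gamma> \<in> SL2Z" and \<tau>: "\<tau> \<in> upper_half_plane" for \<gamma> \<tau>
  proof -
    define \<tau>' where "\<tau>' = act \<gamma> \<tau>"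
    define A B C D where "A = complex_of_int (\<gamma> $ 1 $ 1)" and "B = complex_of_int (\<gamma> $ 1 $ 2)" and
      "C = complex_of_int (\<gamma> $ 2 $ 1)" and "D = complex_of_int (\<gamma> $ 2 $ 2)"
    have "\<gamma> $ 1 $ 1 * \<gamma> $ 2 $ 2 - \<gamma> $ 1 $ 2 * \<gamma> $ 2 $ 1 = 1"
      using \<gamma> by (simp add: SL2Z_def det_2)
    hence "proj_equivariant p y (\<gamma> $ 1 $ 1) (\<gamma> $ 1 $ 2) (\<gamma> $ 2 $ 1) (\<gamma> $ 2 $ 2)"
      by (rule proj_equivariant_SL2Z[OF S T T'])
    then obtain l where \<tau>': "\<tau>' \<in> upper_half_plane" and l: "l \<noteq> 0"
      "p \<tau>' = l * (A * p \<tau> + B * y \<tau>)" "y \<tau>' = l * (C * p \<tau> + D * y \<tau>)"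
      using \<tau> unfolding proj_equivariant_def \<tau>'_def act_def A_def B_def C_def D_def by blast
    have val: "sphere_val h \<tau> = (if y \<tau> = 0 then None else Some (p \<tau> / y \<tau>))"
      if "\<tau> \<in> upper_half_plane" for \<tau>
      using ratio_poles(1)[OF p y W W0 i2 y0 that] by (simp add: sphere_val_def h_def)
    have C0: "\<gamma> $ 2 $ 1 = 0 \<longleftrightarrow> C = 0" by (simp add: C_def)
    have act: "sphere_act \<gamma> w = (case w of None \<Rightarrow> if C = 0 then None else Some (A / C)
                 | Some z \<Rightarrow> if C * z + D = 0 then None else Some ((A * z + B) / (C * z + D)))" for w
      unfolding sphere_act_def act_def moebius_def A_def B_def C_def D_def by simp
    show ?thesis
    proof (cases "y \<tau> = 0")
      case True
      hence "p \<tau> \<noteq> 0" using W[OF \<tau>] W0 by auto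
      with True l show ?thesis
        unfolding \<tau>'_def [symmetric] val[OF \<tau>] val[OF \<tau>'] act by simp
    next
      case False
      define z where "z = p \<tau> / y \<tau>"
      have "p \<tau> = z * y \<tau>" using False by (simp add: z_def)
      hence l': "p \<tau>' = (l * y \<tau>) * (A * z + B)" "y \<tau>' = (l * y \<tau>) * (C * z + D)"
        unfolding l by (simp_all add: algebra_simps)
      show ?thesis
        unfolding \<tau>'_def [symmetric] val[OF \<tau>] val[OF \<tau>'] act l' z_def [symmetric]
        using False l(1) by simp
    qed
  qed
  show ?thesis
    using ratio_poles(2)[OF p y W W0 i2 y0, folded h_def] nonconst sol equi by blast
qed

end
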